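(* There is a constant $h_0$ such that for every $h\ge h_0$ and every $k\ge h$ (so even when $k/h\to\infty$) there is no deterministic online algorithm for the $(h,k)$-server problem that is $2.4$-competitive on general metric spaces; in fact, there exists a depth-$2$ HST on which no deterministic online algorithm with $k$ servers is $2.4$-competitive against an offline optimum with $h$ servers.
   Context: The $(h,k)$-server problem: given a metric space, an online algorithm has $k$ servers; requests arrive one at a time at points, each must be served by moving some server to it; cost is total distance moved. It is compared with an offline optimum using $h\le k$ servers. ALG is $R$-competitive on a metric $M$ if there is a constant $\alpha$ independent of the input such that $ALG_k(I)\le R\cdot OPT_h(I)+\alpha$ for every finite request sequence $I$ of points of $M$. A depth-$2$ tree is an edge-weighted rooted tree with every leaf at depth exactly $2$, requests only at leaves and tree distances; a depth-$2$ HST is such a tree whose edge lengths decrease geometrically from the root towards the leaves. *)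

theory Defs
  imports "HOL-Analysis.Abstract_Metric_Spaces"
begin

section \<open>The $(h,k)$-server problem\<close>

text \<open>
  A configuration of \<open>k\<close> servers is a function giving the position of each server \<open>i < k\<close>; its
  values at other indices are irrelevant. Servers move within a set \<open>M\<close> of points with distance
  \<open>d\<close>, and requests come from a set \<open>Q \<subseteq> M\<close>. A schedule \<open>S\<close> gives the configuration \<open>S t\<close> after
  the first \<open>t\<close> requests, so \<open>S 0\<close> is the initial configuration.
\<close>

definition configuration :: "'a set \<Rightarrow> nat \<Rightarrow> (nat \<Rightarrow> 'a) \<Rightarrow> bool" where
  "configuration M k C \<longleftrightarrow> (\<forall>i<k. C i \<in> M)"

definition serves :: "'a set \<Rightarrow> nat \<Rightarrow> 'a list \<Rightarrow> (nat \<Rightarrow> nat \<Rightarrow> 'a) \<Rightarrow> bool" where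
  "serves M k I S \<longleftrightarrow>
     (\<forall>t\<le>length I. configuration M k (S t)) \<and>
     (\<forall>t<length I. \<exists>i<k. S (Suc t) i = I ! t)"

definition schedule_cost ::
    "('a \<Rightarrow> 'a \<Rightarrow> real) \<Rightarrow> nat \<Rightarrow> nat \<Rightarrow> (nat \<Rightarrow> nat \<Rightarrow> 'a) \<Rightarrow> real" where
  "schedule_cost d k n S = (\<Sum>t<n. \<Sum>i<k. d (S t i) (S (Suc t) i))"

text \<open>The offline optimum for \<open>h\<close> servers that start in the configuration \<open>D\<close>.\<close>

definition opt_cost ::
    "'a set \<Rightarrow> ('a \<Rightarrow> 'a \<Rightarrow> real) \<Rightarrow> nat \<Rightarrow> (nat \<Rightarrow> 'a) \<Rightarrow> 'a list \<Rightarrow> real" where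
  "opt_cost M d h D I =
     Inf {schedule_cost d h (length I) S |S. serves M h I S \<and> (\<forall>i<h. S 0 i = D i)}"

text \<open>
  A deterministic online algorithm maps the sequence of requests seen so far to a configuration;
  the initial configuration \<open>A []\<close> is part of the algorithm.
\<close>

type_synonym 'a algorithm = "'a list \<Rightarrow> nat \<Rightarrow> 'a"

definition run :: "'a algorithm \<Rightarrow> 'a list \<Rightarrow> nat \<Rightarrow> nat \<Rightarrow> 'a" where
  "run A I t = A (take t I)"

definition online_algorithm :: "'a set \<Rightarrow> 'a set \<Rightarrow> nat \<Rightarrow> 'a algorithm \<Rightarrow> bool" where
  "online_algorithm M Q k A \<longleftrightarrow> (\<forall>I\<in>lists Q. serves M k I (run A I))"

definition alg_cost :: "('a \<Rightarrow> 'a \<Rightarrow> real) \<Rightarrow> nat \<Rightarrow> 'a algorithm \<Rightarrow> 'a list \<Rightarrow> real" where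
  "alg_cost d k A I = schedule_cost d k (length I) (run A I)"

text \<open>
  The additive constant \<open>\<alpha>\<close> may depend on the initial configurations \<open>A []\<close> and \<open>D\<close>, but not on
  the requests.
\<close>

definition competitive ::
    "'a set \<Rightarrow> 'a set \<Rightarrow> ('a \<Rightarrow> 'a \<Rightarrow> real) \<Rightarrow> nat \<Rightarrow> nat \<Rightarrow> (nat \<Rightarrow> 'a) \<Rightarrow> real \<Rightarrow> 'a algorithm \<Rightarrow> bool"
  where
  "competitive M Q d h k D R A \<longleftrightarrow>
     (\<exists>\<alpha>. \<forall>I\<in>lists Q. alg_cost d k A I \<le> R * opt_cost M d h D I + \<alpha>)"

section \<open>Depth-2 trees and HSTs\<close>

text \<open>
  A finite rooted tree is given by its parent map, where by convention the root is its own parent.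
  For a vertex \<open>v\<close> other than the root, \<open>len T v\<close> is the length of the edge from \<open>v\<close> to its parent.
\<close>

record 'v wtree =
  verts :: "'v set"
  root :: 'v
  parent :: "'v \<Rightarrow> 'v"
  len :: "'v \<Rightarrow> real"

definition rooted_tree :: "'v wtree \<Rightarrow> bool" where
  "rooted_tree T \<longleftrightarrow>
     finite (verts T) \<and> root T \<in> verts T \<and> parent T (root T) = root T \<and>
     (\<forall>v\<in>verts T. parent T v \<in> verts T) \<and>
     (\<forall>v\<in>verts T. \<exists>n. (parent T ^^ n) v = root T) \<and>
     (\<forall>v\<in>verts T - {root T}. len T v > 0)"

definition depth :: "'v wtree \<Rightarrow> 'v \<Rightarrow> nat" where
  "depth T v = (LEAST n. (parent T ^^ n) v = root T)"

definition leaves :: "'v wtree \<Rightarrow> 'v set" where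
  "leaves T = {v \<in> verts T. \<forall>u \<in> verts T - {root T}. parent T u \<noteq> v}"

definition ancestors :: "'v wtree \<Rightarrow> 'v \<Rightarrow> 'v set" where
  "ancestors T v = {(parent T ^^ n) v |n. True}"

text \<open>
  Identify each edge with its lower endpoint. Since \<open>v \<in> ancestors T v\<close>, the edges on the path
  from \<open>u\<close> to \<open>v\<close> are exactly those in the symmetric difference of the two ancestor sets (both
  contain the root, which has no edge).
\<close>

definition tree_dist :: "'v wtree \<Rightarrow> 'v \<Rightarrow> 'v \<Rightarrow> real" where
  "tree_dist T u v =
     (\<Sum>x \<in> (ancestors T u - ancestors T v) \<union> (ancestors T v - ancestors T u). len T x)"

definition depth2_tree :: "'v wtree \<Rightarrow> bool" where
  "depth2_tree T \<longleftrightarrow> rooted_tree T \<and> (\<forall>v\<in>leaves T. depth T v = 2)"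

definition depth2_HST :: "'v wtree \<Rightarrow> bool" where
  "depth2_HST T \<longleftrightarrow> depth2_tree T \<and>
     (\<exists>\<sigma>>1. \<forall>v\<in>verts T - {root T}. parent T v \<noteq> root T \<longrightarrow>
        len T v \<le> len T (parent T v) / \<sigma>)"

end

theory Submission
  imports Defs
begin

text \<open>
  The tree has \<open>k + 1\<close> stars, so there is always a star without online servers. In it, the adversary
  keeps requesting the first leaf that the online algorithm does not cover. If \<open>i\<close> online servers
  have entered the star, at cost \<open>i\<close> for the long edges, these requests stay among \<open>i + 1\<close> leaves, and the
  online algorithm moves on every one of them. An offline algorithm may decide in hindsight to
  bring \<open>j\<close> servers; averaging over all \<open>j\<close>-sets of leaves that contain the last request, it moves
  only on a fraction \<open>(i - j + 1) / i\<close> of the requests (on none, if \<open>i < j\<close>).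

  If \<open>x i\<close> is the online cost within the star while \<open>i\<close> servers have entered, then 2.4-competitiveness
  at the moment when the \<open>m\<close>-th server enters means
  \<open>m + (\<Sum>i<m. x i) \<le> 2.4 * (j + (\<Sum>i<m. miss_rate j i * x i))\<close> up to small terms, for all \<open>j\<close>. Already for
  \<open>m \<le> 15\<close> these linear inequalities have no nonnegative solution. So the adversary can end the
  round with a gain bounded away from \<open>0\<close> and start again in another empty star.
\<close>

section \<open>The tree\<close>

text \<open>
  Small enough that bringing \<open>j\<close> servers to new leaves each time the set of leaves grows is
  negligible.
\<close>

definition leaf_len :: real where "leaf_len = 1 / 10000"

text \<open>
  Vertex \<open>0\<close> is the root, the vertices \<open>1, \<dots>, s\<close> are the centres of \<open>s\<close> stars with 15 leaves each.
\<close>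

definition star_leaf :: "nat \<Rightarrow> nat \<Rightarrow> nat \<Rightarrow> nat" where
  "star_leaf s x l = s + 15 * x + l"

text \<open>The 15 leaves of star \<open>x\<close> are consecutive numbers starting at
  \<open>s + 15 * x\<close>, so integer division recovers the centre. As \<open>x \<ge> 1\<close>,
  leaf numbers exceed \<open>s\<close>, and the test \<open>v \<le> s\<close> separates them from
  the root and the centres.\<close>

definition star_tree :: "nat \<Rightarrow> nat wtree" where
  "star_tree s =
     \<lparr>verts = {..s} \<union> {star_leaf s x l |x l. x \<in> {1..s} \<and> l < 15}, root = 0,
      parent = (\<lambda>v. if v \<le> s then 0 else (v - s) div 15),
      len = (\<lambda>v. if v \<le> s then 1 else leaf_len)\<rparr>"

lemma star_tree_simps [simp]:
  "root (star_tree s) = 0"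
  "parent (star_tree s) v = (if v \<le> s then 0 else (v - s) div 15)"
  "len (star_tree s) v = (if v \<le> s then 1 else leaf_len)"
  by (simp_all add: star_tree_def)

lemma leaf_len_pos: "0 < leaf_len"
  by (simp add: leaf_len_def)

lemma star_leaf_gt: "1 \<le> x \<Longrightarrow> s < star_leaf s x l"
  by (simp add: star_leaf_def)

lemma parent_star_leaf: "1 \<le> x \<Longrightarrow> l < 15 \<Longrightarrow> parent (star_tree s) (star_leaf s x l) = x"
  by (simp add: star_leaf_def)

lemma verts_star_tree:
  "v \<in> verts (star_tree s) \<longleftrightarrow> v \<le> s \<or> (\<exists>x\<in>{1..s}. \<exists>l<15. v = star_leaf s x l)"
  by (auto simp: star_tree_def)

lemma star_leaf_in_verts: "x \<in> {1..s} \<Longrightarrow> l < 15 \<Longrightarrow> star_leaf s x l \<in> verts (star_tree s)"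
  by (auto simp: verts_star_tree)

lemma verts_star_tree_cases:
  assumes "v \<in> verts (star_tree s)"
  obtains (root) "v = 0" | (centre) "v \<in> {1..s}" | (leaf) x l where "x \<in> {1..s}" "l < 15" "v = star_leaf s x l"
proof (cases "v = 0")
  case False
  with assms show ?thesis
    unfolding verts_star_tree by (auto intro: centre leaf)
qed (rule root)

lemma leaves_star_tree:
  assumes "1 \<le> s"
  shows "leaves (star_tree s) = {star_leaf s x l |x l. x \<in> {1..s} \<and> l < 15}"
proof (intro set_eqI iffI)
  fix v assume v: "v \<in> leaves (star_tree s)"
  then have no_child: "parent (star_tree s) u \<noteq> v" if "u \<in> verts (star_tree s)" "u \<noteq> 0" for u
    using that by (auto simp: leaves_def)
  have "v \<in> verts (star_tree s)"
    using v by (simp add: leaves_def)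
  then show "v \<in> {star_leaf s x l |x l. x \<in> {1..s} \<and> l < 15}"
  proof (cases rule: verts_star_tree_cases)
    case root
    then show ?thesis
      using no_child[of 1] assms by (simp add: verts_star_tree)
  next
    case centre
    then show ?thesis
      using no_child[of "star_leaf s v 0"] parent_star_leaf[of v 0 s] star_leaf_gt[of v s 0]
        star_leaf_in_verts[of v s 0] by auto
  qed blast
next
  fix v assume "v \<in> {star_leaf s x l |x l. x \<in> {1..s} \<and> l < 15}"
  then obtain x l where v: "x \<in> {1..s}" "l < 15" "v = star_leaf s x l"
    by blast
  have "parent (star_tree s) u \<le> s" if "u \<in> verts (star_tree s)" for u
    using that
  proof (cases rule: verts_star_tree_cases)
    case (leaf y l)
    then show ?thesis
      using parent_star_leaf[of y l s] by simp
  qed simp_all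
  then show "v \<in> leaves (star_tree s)"
    using v star_leaf_in_verts[of x s l] star_leaf_gt[of x s l]
    unfolding leaves_def by fastforce
qed

lemma leaves_subset_verts: "leaves T \<subseteq> verts T"
  by (auto simp: leaves_def)

lemma parent_pow_star_tree:
  assumes "v \<in> verts (star_tree s)"
  shows "(parent (star_tree s) ^^ Suc (Suc n)) v = 0"
proof -
  have "parent (star_tree s) v \<le> s"
    using assms
  proof (cases rule: verts_star_tree_cases)
    case (leaf x l)
    then show ?thesis
      using parent_star_leaf[of x l s] by simp
  qed simp_all
  then have "parent (star_tree s) (parent (star_tree s) v) = 0"
    by simp
  moreover have "(parent (star_tree s) ^^ n) 0 = 0" for n
    by (induction n) auto
  ultimately show ?thesis
    by (simp only: funpow_Suc_right comp_def)
qed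

lemma finite_verts_star_tree: "finite (verts (star_tree s))"
proof -
  have "verts (star_tree s) = {..s} \<union> (\<lambda>(x, l). star_leaf s x l) ` ({1..s} \<times> {..<15})"
    by (fastforce simp: star_tree_def)
  then show ?thesis
    by simp
qed

lemma ancestors_star_tree:
  assumes "v \<in> verts (star_tree s)"
  shows "ancestors (star_tree s) v = {v, parent (star_tree s) v, 0}"
proof (intro equalityI subsetI)
  fix u assume "u \<in> ancestors (star_tree s) v"
  then obtain n where u: "u = (parent (star_tree s) ^^ n) v"
    by (auto simp: ancestors_def)
  consider "n = 0" | "n = Suc 0" | m where "n = Suc (Suc m)"
    by (metis not0_implies_Suc)
  then show "u \<in> {v, parent (star_tree s) v, 0}"
  proof cases
    case 3
    then show ?thesis
      using u parent_pow_star_tree[OF assms, of m] by (simp only: insert_iff simp_thms)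
  qed (use u in simp_all)
next
  fix u assume "u \<in> {v, parent (star_tree s) v, 0}"
  moreover have "v = (parent (star_tree s) ^^ 0) v" "parent (star_tree s) v = (parent (star_tree s) ^^ 1) v"
    "0 = (parent (star_tree s) ^^ Suc (Suc 0)) v"
    using parent_pow_star_tree[OF assms, of 0] by simp_all
  ultimately show "u \<in> ancestors (star_tree s) v"
    unfolding ancestors_def by blast
qed

lemma ancestors_root: "ancestors (star_tree s) 0 = {0}"
  using ancestors_star_tree[of 0 s] by (simp add: verts_star_tree)

lemma ancestors_centre: "x \<in> {1..s} \<Longrightarrow> ancestors (star_tree s) x = {x, 0}"
  using ancestors_star_tree[of x s] by (simp add: verts_star_tree)

lemma ancestors_leaf:
  "x \<in> {1..s} \<Longrightarrow> l < 15 \<Longrightarrow> ancestors (star_tree s) (star_leaf s x l) = {star_leaf s x l, x, 0}"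
  using ancestors_star_tree[of "star_leaf s x l" s] parent_star_leaf[of x l s] star_leaf_in_verts[of x s l]
  by (simp del: star_tree_simps)

lemma rooted_star_tree: "rooted_tree (star_tree s)"
proof -
  have "parent (star_tree s) v \<in> verts (star_tree s)" if "v \<in> verts (star_tree s)" for v
    using that
  proof (cases rule: verts_star_tree_cases)
    case (leaf x l)
    then show ?thesis
      using parent_star_leaf[of x l s] by (simp add: verts_star_tree)
  qed (simp_all add: verts_star_tree)
  moreover have "\<exists>n. (parent (star_tree s) ^^ n) v = 0" if "v \<in> verts (star_tree s)" for v
    using parent_pow_star_tree[OF that] by blast
  ultimately show ?thesis
    unfolding rooted_tree_def using finite_verts_star_tree leaf_len_pos
    by (simp del: star_tree_simps(2)) (simp add: verts_star_tree)
qed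

lemma depth2_HST_star_tree:
  assumes "1 \<le> s"
  shows "depth2_HST (star_tree s)"
proof -
  have "depth (star_tree s) v = 2" if v: "v \<in> leaves (star_tree s)" for v
  proof -
    obtain x l where x: "x \<in> {1..s}" "l < 15" and v_eq: "v = star_leaf s x l"
      using v by (auto simp: leaves_star_tree[OF assms])
    have "v \<noteq> 0" "parent (star_tree s) v \<noteq> 0"
      using x parent_star_leaf[of x l s] star_leaf_gt[of x s l] v_eq by (auto simp del: star_tree_simps)
    then have "2 \<le> n" if "(parent (star_tree s) ^^ n) v = 0" for n
      using that by (cases n; cases "n - 1") (auto simp del: star_tree_simps)
    moreover have "(parent (star_tree s) ^^ 2) v = 0"
      using parent_pow_star_tree[OF subsetD[OF leaves_subset_verts v], of 0] by (simp only: numeral_2_eq_2)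
    ultimately show ?thesis
      unfolding depth_def star_tree_simps(1) by (intro Least_equality)
  qed
  \<comment> \<open>The ratio \<sigma> = 2 suffices: long edges have length 1, short ones
    1/10000.\<close>
  moreover have "len (star_tree s) v \<le> len (star_tree s) (parent (star_tree s) v) / 2"
    if v: "v \<in> verts (star_tree s)" and "parent (star_tree s) v \<noteq> 0" for v
    using v
  proof (cases rule: verts_star_tree_cases)
    case (leaf x l)
    then show ?thesis
      using parent_star_leaf[of x l s] star_leaf_gt[of x s l] by (simp add: leaf_len_def)
  qed (use that(2) in auto)
  ultimately show ?thesis
    unfolding depth2_HST_def depth2_tree_def star_tree_simps(1)
    using rooted_star_tree by (intro conjI exI[of _ 2]) auto
qed
section \<open>The linear program\<close>

text \<open>With \<open>i < j\<close> the \<open>j\<close> offline servers cover all leaves in use: the value is \<open>0\<close>.\<close>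

definition miss_rate :: "nat \<Rightarrow> nat \<Rightarrow> real" where
  "miss_rate j i = (real (max i (j - 1)) + 1 - real j) / real (max i (j - 1))"

text \<open>Half of the offline cost of \<open>N\<close> requests; the last term pays for the growth of the set of leaves in use.\<close>

definition adversary_bound :: "nat \<Rightarrow> (nat \<Rightarrow> nat) \<Rightarrow> nat \<Rightarrow> real" where
  "adversary_bound j e N =
     real j * (1 + leaf_len) + leaf_len * (\<Sum>n=1..<N. miss_rate j (e n)) + 14 * real j * leaf_len"

text \<open>A Farkas certificate of infeasibility. The tolerance 1/10 covers the small terms in
  \<open>leaf_len\<close> and a fixed gain per round.\<close>

lemma no_online_level_times:
  fixes x :: "nat \<Rightarrow> real"
  assumes nonneg: "\<And>i. 0 \<le> x i"
    and bound: "\<And>m j. m \<in> {1..15} \<Longrightarrow> j \<in> {1..15} \<Longrightarrow>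
      real m + (\<Sum>i=1..<m. x i) < 2.4 * (real j + (\<Sum>i=1..<m. miss_rate j i * x i)) + 1/10"
  shows False
proof -
  \<comment> \<open>rounded dual solution of the linear program\<close>
  define weights :: "(real \<times> nat \<times> nat) list" where "weights =
    [(10,15,9), (2,15,10), (2,14,6), (3,13,5), (4,12,5), (4,11,4), (5,10,3), (3,9,1), (2,8,1),
     (2,7,1), (4,6,1), (4,5,1), (3,4,1), (3,3,1)]"
  define slack where "slack m j =
    2.4 * (real j + (\<Sum>i=1..<m. miss_rate j i * x i)) + 1/10 - (real m + (\<Sum>i=1..<m. x i))" for m j
  have "0 \<le> y * slack m j" if "(y, m, j) \<in> set weights" for y m j
  proof -
    have "m \<in> {1..15}" "j \<in> {1..15}" "0 \<le> y"
      using that by (auto simp: weights_def)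
    with bound[of m j] show ?thesis by (simp add: slack_def)
  qed
  then have "0 \<le> (\<Sum>(y, m, j)\<leftarrow>weights. y * slack m j)"
    by (intro sum_list_nonneg) auto
  \<comment> \<open>In the weighted sum the constant term is -4.3 and no \<open>x i\<close> has a
    positive coefficient, so it cannot be nonnegative.\<close>
  then show False
    using nonneg[of 1] nonneg[of 2] nonneg[of 3] nonneg[of 4] nonneg[of 5] nonneg[of 6] nonneg[of 7]
      nonneg[of 8] nonneg[of 9] nonneg[of 10] nonneg[of 11] nonneg[of 12] nonneg[of 13]
      nonneg[of 14]
    by (simp add: weights_def slack_def miss_rate_def atLeastLessThan_nat_numeral) argo
qed
text \<open>Here \<open>e n\<close> stands for the number of entries after \<open>n\<close>
  requests. If stopping never paid off, the costs collected at the levels of \<open>e\<close> would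
  solve the linear program. Both sides of the final inequality stand for half of a cost.\<close>

lemma adversary_can_stop:
  fixes e :: "nat \<Rightarrow> nat"
  assumes "mono e" and e0: "e 0 = 0" and e_pos: "\<And>n. 1 \<le> n \<Longrightarrow> 1 \<le> e n"
  obtains N j where "1 \<le> N" "j \<in> {1..15}" "\<And>n. n < N \<Longrightarrow> e n \<le> 14"
    "2.4 * adversary_bound j e N + 1/25 \<le> real (e N) + leaf_len * real N"
proof (rule ccontr)
  note stop = that
  assume neg: "\<not> thesis"
  have cheap: "real (e N) + leaf_len * real N < 2.4 * adversary_bound j e N + 1/25"
    if "1 \<le> N" "j \<in> {1..15}" "\<And>n. n < N \<Longrightarrow> e n \<le> 14" for N j
    using neg stop[OF that] by (meson not_le_imp_less)
  have "\<exists>n. 15 \<le> e n"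
  proof (rule ccontr)
    assume "\<nexists>n. 15 \<le> e n"
    then have "\<not> 15 \<le> e n" for n
      by blast
    then have le: "e n \<le> 14" for n
      using linorder_not_le[of 15 "e n"] by (simp add: less_Suc_eq_le)
    \<comment> \<open>If at most 14 entries ever occur, 15 offline servers cover all leaves in use
      and pay nothing after their arrival, while \<open>10^6\<close> requests give
      \<open>leaf_len * N = 100\<close>, far above 2.4 * 15 plus small terms.\<close>
    have free: "miss_rate 15 (e n) = 0" for n
      using le[of n] by (simp add: miss_rate_def)
    obtain N :: nat where N: "real N = 10^6" "1 \<le> N"
      by (rule that[of "10^6"]) auto
    show False
      using cheap[of N 15] le N by (simp add: adversary_bound_def leaf_len_def free)
  qed
  then obtain L where L: "15 \<le> e L"
    by blast
  \<comment> \<open>Half of the online cost on short edges while there are exactly \<open>i\<close>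
    entries. Request 0 belongs to level 0 and is left out.\<close>
  define x where "x i = leaf_len * real (card {n \<in> {1..<L}. e n = i})" for i
  show False
  proof (rule no_online_level_times[of x])
    show "0 \<le> x i" for i
      by (simp add: x_def leaf_len_def)
    fix m j :: nat
    assume m: "m \<in> {1..15}" and j: "j \<in> {1..15}"
    \<comment> \<open>The first time with at least \<open>m\<close> entries; several servers may
      enter at once, so \<open>e N\<close> can exceed \<open>m\<close>.\<close>
    define N where "N = (LEAST n. m \<le> e n)"
    have "m \<le> e L"
      using L m by auto
    then have "m \<le> e N" "N \<le> L"
      unfolding N_def by (rule LeastI, rule Least_le)
    have below: "e n < m" if "n < N" for n
      using not_less_Least[OF that[unfolded N_def]] by simp
    have "1 \<le> N"
      using \<open>m \<le> e N\<close> m e0 by (cases N) auto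
    have N_iff: "n < N \<longleftrightarrow> e n < m" for n
      using below \<open>m \<le> e N\<close> monoD[OF \<open>mono e\<close>, of N n] by (meson le_less_trans leD leI)
    have sum_levels: "leaf_len * (\<Sum>n=1..<N. f (e n)) = (\<Sum>i=1..<m. f i * x i)" for f :: "nat \<Rightarrow> real"
    proof -
      have "(\<Sum>n=1..<N. f (e n)) = (\<Sum>i=1..<m. \<Sum>n\<in>{n \<in> {1..<N}. e n = i}. f (e n))"
      proof (rule sum.group[symmetric])
        show "e ` {1..<N} \<subseteq> {1..<m}"
          using below e_pos by (intro image_subsetI) simp
      qed simp_all
      also have "\<dots> = (\<Sum>i=1..<m. f i * real (card {n \<in> {1..<L}. e n = i}))"
      proof (rule sum.cong)
        fix i assume "i \<in> {1..<m}"
        then have "i < m"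
          by simp
        \<comment> \<open>By monotonicity a level below \<open>m\<close> is over before time
          \<open>N\<close>, so counting up to \<open>L\<close> changes nothing.\<close>
        have levels: "{n \<in> {1..<N}. e n = i} = {n \<in> {1..<L}. e n = i}"
        proof (intro Collect_cong rev_conj_cong refl)
          fix n assume "e n = i"
          with N_iff[of n] \<open>i < m\<close> have "n < N" by blast
          with \<open>N \<le> L\<close> have "n < L" by simp
          with \<open>n < N\<close> show "n \<in> {1..<N} \<longleftrightarrow> n \<in> {1..<L}" by simp
        qed
        have "(\<Sum>n\<in>{n \<in> {1..<N}. e n = i}. f (e n)) = (\<Sum>n\<in>{n \<in> {1..<N}. e n = i}. f i)"
          by (rule sum.cong) auto
        then show "(\<Sum>n\<in>{n \<in> {1..<N}. e n = i}. f (e n)) = f i * real (card {n \<in> {1..<L}. e n = i})"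
          by (simp only: levels sum_constant mult.commute)
      qed simp
      finally show ?thesis
        by (simp add: x_def sum_distrib_left mult_ac)
    qed
    have "real m + (\<Sum>i=1..<m. x i) = real m + leaf_len * (real N - 1)"
      using sum_levels[of "\<lambda>_. 1"] \<open>1 \<le> N\<close> by (simp add: of_nat_diff)
    also have "\<dots> \<le> real (e N) + leaf_len * real N"
      using of_nat_mono[OF \<open>m \<le> e N\<close>, where ?'a = real] unfolding leaf_len_def by argo
    also have "\<dots> < 2.4 * adversary_bound j e N + 1/25"
    proof (rule cheap[OF \<open>1 \<le> N\<close> j])
      fix n assume "n < N"
      then show "e n \<le> 14"
        using below[of n] m by simp
    qed
    also have "\<dots> = 2.4 * (real j + (\<Sum>i=1..<m. miss_rate j i * x i)) + 2.4 * 15 * leaf_len * real j + 1/25"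
      unfolding adversary_bound_def sum_levels[of "miss_rate j"] by (simp add: algebra_simps)
    \<comment> \<open>Since \<open>j \<le> 15\<close>, the extra term is at most 0.054, and 0.054 +
      1/25 < 1/10.\<close>
    also have "\<dots> \<le> 2.4 * (real j + (\<Sum>i=1..<m. miss_rate j i * x i)) + 1/10"
      using j by (simp add: leaf_len_def)
    finally show "real m + (\<Sum>i=1..<m. x i) < 2.4 * (real j + (\<Sum>i=1..<m. miss_rate j i * x i)) + 1/10" .
  qed
qed

section \<open>Distances\<close>

text \<open>The distance of \<open>v\<close> from the root, as edges are identified with their lower
  endpoints.\<close>

definition height :: "nat \<Rightarrow> nat \<Rightarrow> real" where
  "height s v = (\<Sum>x\<in>ancestors (star_tree s) v - {0}. len (star_tree s) x)"

text \<open>The length of the part of the path from \<open>u\<close> to \<open>v\<close> that leads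
  away from the root.\<close>

definition down :: "nat \<Rightarrow> nat \<Rightarrow> nat \<Rightarrow> real" where
  "down s u v = (\<Sum>x\<in>ancestors (star_tree s) v - ancestors (star_tree s) u. len (star_tree s) x)"

lemma finite_ancestors [simp]: "v \<in> verts (star_tree s) \<Longrightarrow> finite (ancestors (star_tree s) v)"
  by (simp add: ancestors_star_tree)

lemma len_star_tree_nonneg: "0 \<le> len (star_tree s) v"
  using leaf_len_pos by simp

lemma height_nonneg: "0 \<le> height s v"
  unfolding height_def by (intro sum_nonneg len_star_tree_nonneg)

lemma height_le:
  assumes "v \<in> verts (star_tree s)"
  shows "height s v \<le> 1 + leaf_len"
  using assms
proof (cases rule: verts_star_tree_cases)
  case root
  then show ?thesis
    using leaf_len_pos by (simp add: height_def ancestors_root)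
next
  case centre
  then show ?thesis
    using leaf_len_pos by (simp add: height_def ancestors_centre insert_Diff_if)
next
  case (leaf x l)
  then have "ancestors (star_tree s) v - {0} = {v, x}" "x \<le> s" "s < v"
    using star_leaf_gt[of x s l] by (auto simp: ancestors_leaf)
  then show ?thesis
    by (simp add: height_def)
qed

lemma down_le_height:
  assumes "u \<in> verts (star_tree s)" "v \<in> verts (star_tree s)"
  shows "down s u v \<le> height s v"
  unfolding down_def height_def using assms
  by (intro sum_mono2 len_star_tree_nonneg) (auto simp: ancestors_star_tree[of u])

lemma tree_dist_eq_down:
  assumes "u \<in> verts (star_tree s)" "v \<in> verts (star_tree s)"
  shows "tree_dist (star_tree s) u v = down s u v + down s v u"
  unfolding tree_dist_def down_def using assms
  by (subst sum.union_disjoint) (auto simp del: star_tree_simps)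

text \<open>Up to a change of potential, only the downward part of a movement has to be paid, at twice its length.\<close>

lemma tree_dist_potential:
  assumes "u \<in> verts (star_tree s)" "v \<in> verts (star_tree s)"
  shows "tree_dist (star_tree s) u v = 2 * down s u v + height s u - height s v"
proof -
  \<comment> \<open>Either order of the two vertices gives the total length of the union of their
    paths to the root.\<close>
  have sum_union: "down s a b + height s a = (\<Sum>x\<in>(ancestors (star_tree s) a \<union> ancestors (star_tree s) b) - {0}. len (star_tree s) x)"
    if "a \<in> verts (star_tree s)" "b \<in> verts (star_tree s)" for a b
  proof -
    have "ancestors (star_tree s) b - ancestors (star_tree s) a \<union> (ancestors (star_tree s) a - {0})
        = (ancestors (star_tree s) a \<union> ancestors (star_tree s) b) - {0}"
      using that by (auto simp: ancestors_star_tree[of a])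
    then show ?thesis
      unfolding down_def height_def using that
      by (subst sum.union_disjoint[symmetric]) auto
  qed
  have "down s u v + height s u = down s v u + height s v"
    using sum_union[OF assms] sum_union[OF assms(2,1)] by (simp only: Un_commute)
  then show ?thesis
    using tree_dist_eq_down[OF assms] by simp
qed

lemma tree_dist_le:
  assumes "u \<in> verts (star_tree s)" "v \<in> verts (star_tree s)"
  shows "tree_dist (star_tree s) u v \<le> 2 * (1 + leaf_len)"
  using tree_dist_eq_down[OF assms] down_le_height[OF assms] down_le_height[OF assms(2,1)]
    height_le[OF assms(1)] height_le[OF assms(2)] by simp

lemma tree_dist_self [simp]: "tree_dist T u u = 0"
  by (simp add: tree_dist_def)

lemma tree_dist_same_star_le:
  assumes "x \<in> {1..s}" "l < 15" "l' < 15"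
  shows "tree_dist (star_tree s) (star_leaf s x l) (star_leaf s x l') \<le> 2 * leaf_len"
proof -
  have down_le: "down s (star_leaf s x a) (star_leaf s x b) \<le> leaf_len" if "a < 15" "b < 15" for a b
  proof -
    have "down s (star_leaf s x a) (star_leaf s x b) \<le> (\<Sum>y\<in>{star_leaf s x b}. len (star_tree s) y)"
      unfolding down_def using assms that
      by (intro sum_mono2 len_star_tree_nonneg) (auto simp: ancestors_leaf)
    then show ?thesis
      using star_leaf_gt[of x s b] assms by simp
  qed
  show ?thesis
    using down_le[OF assms(2,3)] down_le[OF assms(3,2)] assms
    by (simp add: tree_dist_eq_down star_leaf_in_verts)
qed

text \<open>Entering star \<open>x\<close> means descending the long edge above its centre; arriving
  at the leaf means descending the short edge above it. These edges are distinct, so one server can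
  be charged for both.\<close>

lemma down_ge:
  assumes "x \<in> {1..s}" "l < 15" "u \<in> verts (star_tree s)" "v \<in> verts (star_tree s)"
  shows "of_bool (x \<in> ancestors (star_tree s) v \<and> x \<notin> ancestors (star_tree s) u)
      + leaf_len * of_bool (v = star_leaf s x l \<and> u \<noteq> v) \<le> down s u v"
proof -
  let ?A = "{x} \<inter> (ancestors (star_tree s) v - ancestors (star_tree s) u)"
  let ?B = "if v = star_leaf s x l \<and> u \<noteq> v then {v} else {}"
  have "v \<notin> ancestors (star_tree s) u" if "v = star_leaf s x l" "u \<noteq> v"
    using assms(3) that
  proof (cases rule: verts_star_tree_cases)
    case (leaf y m)
    then show ?thesis
      using that star_leaf_gt[of x s l] assms by (auto simp: ancestors_leaf)
  qed (use star_leaf_gt[of x s l] assms in \<open>auto simp: ancestors_root ancestors_centre\<close>)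
  then have "?A \<union> ?B \<subseteq> ancestors (star_tree s) v - ancestors (star_tree s) u"
    using assms by (auto simp: ancestors_leaf split: if_splits)
  then have "(\<Sum>y\<in>?A \<union> ?B. len (star_tree s) y) \<le> down s u v"
    unfolding down_def using assms by (intro sum_mono2 len_star_tree_nonneg) auto
  moreover have "?A \<inter> ?B = {}"
    using star_leaf_gt[of x s l] assms by auto
  ultimately have "(\<Sum>y\<in>?A. len (star_tree s) y) + (\<Sum>y\<in>?B. len (star_tree s) y) \<le> down s u v"
    by (subst sum.union_disjoint[symmetric]) auto
  moreover have "(\<Sum>y\<in>?A. len (star_tree s) y) = of_bool (x \<in> ancestors (star_tree s) v \<and> x \<notin> ancestors (star_tree s) u)"
    using assms by (auto simp: Int_insert_left)
  moreover have "(\<Sum>y\<in>?B. len (star_tree s) y) = leaf_len * of_bool (v = star_leaf s x l \<and> u \<noteq> v)"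
    using star_leaf_gt[of x s l] assms by simp
  ultimately show ?thesis
    by simp
qed

lemma Metric_space_star_tree: "Metric_space (verts (star_tree s)) (tree_dist (star_tree s))"
proof (rule Metric_space.intro)
  fix u v
  show "0 \<le> tree_dist (star_tree s) u v"
    unfolding tree_dist_def by (intro sum_nonneg len_star_tree_nonneg)
  show "tree_dist (star_tree s) u v = tree_dist (star_tree s) v u"
    unfolding tree_dist_def by (subst Un_commute) (rule refl)
next
  fix u v assume uv: "u \<in> verts (star_tree s)" "v \<in> verts (star_tree s)"
  show "tree_dist (star_tree s) u v = 0 \<longleftrightarrow> u = v"
  proof
    assume zero: "tree_dist (star_tree s) u v = 0"
    let ?S = "(ancestors (star_tree s) u - ancestors (star_tree s) v)
        \<union> (ancestors (star_tree s) v - ancestors (star_tree s) u)"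
    have "finite ?S"
      by (intro finite_UnI finite_Diff finite_ancestors uv)
    have len_pos: "0 < len (star_tree s) x" for x
      using leaf_len_pos by simp
    have "?S = {}"
    proof (rule ccontr)
      assume "?S \<noteq> {}"
      then have "0 < sum (len (star_tree s)) ?S"
        using \<open>finite ?S\<close> len_pos by (intro sum_pos)
      with zero show False
        by (simp only: tree_dist_def)
    qed
    then have eq: "ancestors (star_tree s) u = ancestors (star_tree s) v"
      by blast
    \<comment> \<open>Numbers increase away from the root, so a vertex is the largest of its
      ancestors.\<close>
    have Max: "Max (ancestors (star_tree s) w) = w" if "w \<in> verts (star_tree s)" for w
      using that
    proof (cases rule: verts_star_tree_cases)
      case (leaf x l)
      then show ?thesis
        using star_leaf_gt[of x s l] by (simp add: ancestors_leaf)
    qed (simp_all add: ancestors_root ancestors_centre)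
    show "u = v"
      using Max[OF uv(1), unfolded eq] Max[OF uv(2)] by (rule subst)
  qed simp
next
  fix u v w assume uvw: "u \<in> verts (star_tree s)" "v \<in> verts (star_tree s)" "w \<in> verts (star_tree s)"
  have down_triangle: "down s a c \<le> down s a b + down s b c"
    if "a \<in> verts (star_tree s)" "b \<in> verts (star_tree s)" "c \<in> verts (star_tree s)" for a b c
  proof -
    have "down s a c \<le> (\<Sum>x\<in>(ancestors (star_tree s) b - ancestors (star_tree s) a)
        \<union> (ancestors (star_tree s) c - ancestors (star_tree s) b). len (star_tree s) x)"
      unfolding down_def using that by (intro sum_mono2 len_star_tree_nonneg) auto
    also have "\<dots> = down s a b + down s b c"
      unfolding down_def using that by (intro sum.union_disjoint) auto
    finally show ?thesis .
  qed
  show "tree_dist (star_tree s) u w \<le> tree_dist (star_tree s) u v + tree_dist (star_tree s) v w"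
    using down_triangle[of u v w] down_triangle[of w v u] uvw by (simp add: tree_dist_eq_down)
qed

section \<open>Cost of the online algorithm\<close>

text \<open>Servers at the centre count as well: they reach the leaves without using the long
  edge.\<close>

definition inside :: "nat \<Rightarrow> nat \<Rightarrow> nat \<Rightarrow> (nat \<Rightarrow> nat) \<Rightarrow> nat" where
  "inside s x k C = card {i \<in> {..<k}. x \<in> ancestors (star_tree s) (C i)}"

definition entering :: "nat \<Rightarrow> nat \<Rightarrow> nat \<Rightarrow> (nat \<Rightarrow> nat) \<Rightarrow> (nat \<Rightarrow> nat) \<Rightarrow> nat" where
  "entering s x k C C' =
     card {i \<in> {..<k}. x \<in> ancestors (star_tree s) (C' i) \<and> x \<notin> ancestors (star_tree s) (C i)}"

text \<open>Its changes telescope over the requests and it stays between 0 and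
  \<open>k * (1 + leaf_len)\<close>, so charging only downward moves, at twice their length, alters
  the total cost by a bounded amount.\<close>

definition potential :: "nat \<Rightarrow> nat \<Rightarrow> (nat \<Rightarrow> nat) \<Rightarrow> real" where
  "potential s k C = (\<Sum>i<k. height s (C i))"

lemma inside_le_entering: "inside s x k C' \<le> inside s x k C + entering s x k C C'"
  unfolding inside_def entering_def
  by (rule order_trans[OF card_mono card_Un_le]) auto

text \<open>This is \<open>down_ge\<close> summed over all servers. The server that answers the
  request descends a short edge, since no server was at that leaf before.\<close>

lemma move_cost_ge:
  assumes x: "x \<in> {1..s}" "l < 15"
    and C: "configuration (verts (star_tree s)) k C" "configuration (verts (star_tree s)) k C'"
    and served: "i < k" "C' i = star_leaf s x l" and uncovered: "star_leaf s x l \<notin> C ` {..<k}"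
  shows "2 * (real (entering s x k C C') + leaf_len) + potential s k C - potential s k C'
    \<le> (\<Sum>i<k. tree_dist (star_tree s) (C i) (C' i))"
proof -
  let ?enter = "\<lambda>i. x \<in> ancestors (star_tree s) (C' i) \<and> x \<notin> ancestors (star_tree s) (C i)"
  let ?serve = "\<lambda>i. C' i = star_leaf s x l \<and> C i \<noteq> C' i"
  have enter: "(\<Sum>i<k. of_bool (?enter i)) = real (entering s x k C C')"
    by (simp add: entering_def sum_of_bool_eq Int_def)
  have "C i \<noteq> C' i"
    using served uncovered by (metis imageI lessThan_iff)
  then have "(1::real) = (\<Sum>n\<in>{i}. of_bool (?serve n))"
    using served by simp
  also have "\<dots> \<le> (\<Sum>i<k. of_bool (?serve i))"
    using served by (intro sum_mono2) auto
  finally have "leaf_len * 1 \<le> leaf_len * (\<Sum>i<k. of_bool (?serve i))"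
    using leaf_len_pos by (intro mult_left_mono) auto
  then have "2 * (real (entering s x k C C') + leaf_len) + potential s k C - potential s k C'
      \<le> (\<Sum>i<k. 2 * (of_bool (?enter i) + leaf_len * of_bool (?serve i)) + height s (C i) - height s (C' i))"
    by (simp only: sum.distrib sum_subtractf potential_def flip: enter sum_distrib_left) simp
  also have "\<dots> \<le> (\<Sum>i<k. tree_dist (star_tree s) (C i) (C' i))"
  proof (rule sum_mono)
    fix i assume "i \<in> {..<k}"
    then have "C i \<in> verts (star_tree s)" "C' i \<in> verts (star_tree s)"
      using C by (auto simp: configuration_def)
    from down_ge[OF x this] tree_dist_potential[OF this]
    show "2 * (of_bool (?enter i) + leaf_len * of_bool (?serve i)) + height s (C i) - height s (C' i)
        \<le> tree_dist (star_tree s) (C i) (C' i)"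
      by argo
  qed
  finally show ?thesis .
qed

text \<open>Pigeonhole: no vertex lies in two stars, and there are \<open>k + 1\<close> stars for
  \<open>k\<close> servers.\<close>

lemma exists_empty_star:
  assumes "configuration (verts (star_tree (Suc k))) k C"
  shows "\<exists>x\<in>{1..Suc k}. inside (Suc k) x k C = 0"
proof (rule ccontr)
  assume "\<not> ?thesis"
  then have "\<forall>x\<in>{1..Suc k}. \<exists>i<k. x \<in> ancestors (star_tree (Suc k)) (C i)"
    by (auto simp: inside_def)
  then obtain f where f: "\<And>x. x \<in> {1..Suc k} \<Longrightarrow> f x < k \<and> x \<in> ancestors (star_tree (Suc k)) (C (f x))"
    by metis
  have unique: "x = y" if "x \<in> ancestors (star_tree (Suc k)) v" "y \<in> ancestors (star_tree (Suc k)) v"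
    "x \<in> {1..Suc k}" "y \<in> {1..Suc k}" "v \<in> verts (star_tree (Suc k))" for x y v
    using that(5)
  proof (cases rule: verts_star_tree_cases)
    case (leaf z l)
    then show ?thesis
      using that star_leaf_gt[of z "Suc k" l] by (auto simp: ancestors_leaf)
  qed (use that in \<open>auto simp: ancestors_root ancestors_centre\<close>)
  have "inj_on f {1..Suc k}"
  proof (rule inj_onI)
    fix x y assume xy: "x \<in> {1..Suc k}" "y \<in> {1..Suc k}" "f x = f y"
    then have "C (f x) \<in> verts (star_tree (Suc k))"
      using f assms by (auto simp: configuration_def)
    then show "x = y"
      using unique f[OF xy(1)] f[OF xy(2)] xy by metis
  qed
  moreover have "f ` {1..Suc k} \<subseteq> {..<k}"
    using f by auto
  ultimately have "card {1..Suc k} \<le> card {..<k}"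
    by (intro card_inj_on_le) auto
  then show False
    by simp
qed

text \<open>Pigeonhole on the leaves 0 to \<open>e\<close>, which belong to the star because of
  \<open>e \<le> 14\<close>.\<close>

lemma exists_uncovered_leaf:
  assumes x: "x \<in> {1..s}" and "inside s x k C \<le> e" "e \<le> 14"
  shows "\<exists>l\<le>e. star_leaf s x l \<notin> C ` {..<k}"
proof (rule ccontr)
  assume "\<not> ?thesis"
  then have "\<forall>l\<le>e. \<exists>i<k. C i = star_leaf s x l"
    by (metis imageE lessThan_iff)
  then obtain f where f: "\<And>l. l \<le> e \<Longrightarrow> f l < k \<and> C (f l) = star_leaf s x l"
    by metis
  have "inj_on f {..e}"
  proof (rule inj_onI)
    fix l m assume lm: "l \<in> {..e}" "m \<in> {..e}" "f l = f m"
    then have "star_leaf s x l = star_leaf s x m"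
      using f[of l] f[of m] by simp
    then show "l = m"
      by (simp add: star_leaf_def)
  qed
  moreover have "f ` {..e} \<subseteq> {i \<in> {..<k}. x \<in> ancestors (star_tree s) (C i)}"
    using f x \<open>e \<le> 14\<close> by (auto simp: ancestors_leaf)
  ultimately have "card {..e} \<le> inside s x k C"
    unfolding inside_def by (intro card_inj_on_le) auto
  with assms show False
    by simp
qed

section \<open>Online algorithms on extended request sequences\<close>

lemma online_configuration:
  assumes "online_algorithm M Q k A" "I \<in> lists Q"
  shows "configuration M k (A I)"
proof -
  have "configuration M k (run A I (length I))"
    using assms unfolding online_algorithm_def serves_def by blast
  then show ?thesis
    by (simp add: run_def)
qed

lemma online_serves:
  assumes "online_algorithm M Q k A" "I \<in> lists Q" "q \<in> Q"
  shows "\<exists>i<k. A (I @ [q]) i = q"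
proof -
  have "serves M k (I @ [q]) (run A (I @ [q]))"
    using assms unfolding online_algorithm_def by auto
  then have "\<exists>i<k. run A (I @ [q]) (Suc (length I)) i = (I @ [q]) ! length I"
    unfolding serves_def by (metis length_append_singleton lessI)
  then show ?thesis
    by (simp add: run_def)
qed

lemma alg_cost_snoc:
  "alg_cost d k A (I @ [q]) = alg_cost d k A I + (\<Sum>i<k. d (A I i) (A (I @ [q]) i))"
proof -
  have "run A (I @ [q]) t = run A I t" if "t \<le> length I" for t
    using that by (simp add: run_def)
  then have "(\<Sum>t<length I. \<Sum>i<k. d (run A (I @ [q]) t i) (run A (I @ [q]) (Suc t) i))
      = (\<Sum>t<length I. \<Sum>i<k. d (run A I t i) (run A I (Suc t) i))"
    by (intro sum.cong) simp_all
  then show ?thesis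
    by (simp add: alg_cost_def schedule_cost_def) (simp add: run_def)
qed

section \<open>The adversary's requests within one star\<close>

context
  fixes A :: "nat algorithm" and s k x :: nat and I :: "nat list"
begin

text \<open>Once all 15 leaves of the star are covered, the requested numbers need not be leaves any more.\<close>

primrec hard_requests :: "nat \<Rightarrow> nat list" where
  "hard_requests 0 = I"
| "hard_requests (Suc n) = hard_requests n @
     [star_leaf s x (LEAST l. star_leaf s x l \<notin> A (hard_requests n) ` {..<k})]"

definition hard_leaf :: "nat \<Rightarrow> nat" where
  "hard_leaf n = (LEAST l. star_leaf s x l \<notin> A (hard_requests n) ` {..<k})"

text \<open>Counts entry events, so servers that leave again do not lower it. It is therefore
  monotone, bounds the number of servers inside, and measures the downward traffic over the long
  edge.\<close>

definition entries :: "nat \<Rightarrow> nat" where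
  "entries n = (\<Sum>m<n. entering s x k (A (hard_requests m)) (A (hard_requests (Suc m))))"

lemma hard_requests_Suc: "hard_requests (Suc n) = hard_requests n @ [star_leaf s x (hard_leaf n)]"
  by (simp add: hard_leaf_def)

lemma hard_requests_eq: "hard_requests n = I @ map (\<lambda>m. star_leaf s x (hard_leaf m)) [0..<n]"
  by (induction n) (simp_all add: hard_requests_Suc del: hard_requests.simps(2))

lemma mono_entries: "mono entries"
  unfolding entries_def by (intro monoI sum_mono2) auto

lemma inside_le_entries:
  assumes "inside s x k (A I) = 0"
  shows "inside s x k (A (hard_requests n)) \<le> entries n"
proof (induction n)
  case 0
  then show ?case
    using assms by simp
next
  case (Suc n)
  then show ?case
    using inside_le_entering[of s x k "A (hard_requests (Suc n))" "A (hard_requests n)"]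
    by (simp add: entries_def)
qed

lemma hard_leaf_uncovered:
  assumes x: "x \<in> {1..s}" and empty: "inside s x k (A I) = 0" and "entries n \<le> 14"
  shows "hard_leaf n \<le> entries n" "star_leaf s x (hard_leaf n) \<notin> A (hard_requests n) ` {..<k}"
proof -
  obtain l where "l \<le> entries n" and l: "star_leaf s x l \<notin> A (hard_requests n) ` {..<k}"
    using exists_uncovered_leaf[OF x inside_le_entries[OF empty] \<open>entries n \<le> 14\<close>] by blast
  from l have "hard_leaf n \<le> l"
    unfolding hard_leaf_def by (rule Least_le)
  with \<open>l \<le> entries n\<close> show "hard_leaf n \<le> entries n"
    by simp
  show "star_leaf s x (hard_leaf n) \<notin> A (hard_requests n) ` {..<k}"
    unfolding hard_leaf_def using l by (rule LeastI)
qed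

text \<open>The claims depend on each other: the algorithm is bound to serve a request only while
  all requests are leaves, and serving an uncovered leaf forces a move over a short edge each
  time.\<close>

lemma hard_requests_cost:
  assumes alg: "online_algorithm (verts (star_tree s)) (leaves (star_tree s)) k A"
    and I: "I \<in> lists (leaves (star_tree s))"
    and x: "x \<in> {1..s}" and empty: "inside s x k (A I) = 0"
    and few: "\<And>m. m < n \<Longrightarrow> entries m \<le> 14"
  shows "hard_requests n \<in> lists (leaves (star_tree s)) \<and>
      alg_cost (tree_dist (star_tree s)) k A I + 2 * (real (entries n) + leaf_len * real n)
        + potential s k (A I) - potential s k (A (hard_requests n))
      \<le> alg_cost (tree_dist (star_tree s)) k A (hard_requests n) \<and>
      (\<forall>m<n. \<exists>i<k. A (hard_requests (Suc m)) i = star_leaf s x (hard_leaf m))"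
  using few
proof (induction n)
  case 0
  then show ?case
    using I by (simp add: entries_def)
next
  case (Suc n)
  have few: "entries m \<le> 14" if "m < n" for m
    using Suc.prems that by simp
  note IH = conjunct1[OF Suc.IH[OF few]] conjunct2[OF Suc.IH[OF few]]
  have "entries n \<le> 14"
    using Suc.prems by simp
  note uncovered = hard_leaf_uncovered[OF x empty this]
  have small: "hard_leaf n < 15"
    using uncovered(1) \<open>entries n \<le> 14\<close> by simp
  have leaf: "star_leaf s x (hard_leaf n) \<in> leaves (star_tree s)"
    using x small leaves_star_tree[of s] by auto
  then have lists: "hard_requests (Suc n) \<in> lists (leaves (star_tree s))"
    using IH(1) by (simp add: hard_requests_Suc del: hard_requests.simps)
  obtain i where i: "i < k" "A (hard_requests (Suc n)) i = star_leaf s x (hard_leaf n)"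
    using online_serves[OF alg IH(1) leaf] by (auto simp: hard_requests_Suc simp del: hard_requests.simps)
  have step: "2 * (real (entering s x k (A (hard_requests n)) (A (hard_requests (Suc n)))) + leaf_len)
      + potential s k (A (hard_requests n)) - potential s k (A (hard_requests (Suc n)))
      \<le> (\<Sum>i<k. tree_dist (star_tree s) (A (hard_requests n) i) (A (hard_requests (Suc n)) i))"
    by (rule move_cost_ge[OF x small online_configuration[OF alg IH(1)] online_configuration[OF alg lists] i uncovered(2)])
  show ?case
  proof (intro conjI allI impI)
    show "hard_requests (Suc n) \<in> lists (leaves (star_tree s))"
      by (rule lists)
    show "alg_cost (tree_dist (star_tree s)) k A I + 2 * (real (entries (Suc n)) + leaf_len * real (Suc n))
        + potential s k (A I) - potential s k (A (hard_requests (Suc n)))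
      \<le> alg_cost (tree_dist (star_tree s)) k A (hard_requests (Suc n))"
      using conjunct1[OF IH(2)] step
      by (simp add: hard_requests_Suc alg_cost_snoc entries_def algebra_simps del: hard_requests.simps)
    fix m assume "m < Suc n"
    then show "\<exists>i<k. A (hard_requests (Suc m)) i = star_leaf s x (hard_leaf m)"
      using conjunct2[OF IH(2)] i less_Suc_eq by blast
  qed
qed

end

section \<open>Offline schedules\<close>

text \<open>Reduces a schedule to its final configuration and a cost bound, which is all that is
  needed to extend it request by request.\<close>

definition reachable ::
    "'a set \<Rightarrow> ('a \<Rightarrow> 'a \<Rightarrow> real) \<Rightarrow> nat \<Rightarrow> (nat \<Rightarrow> 'a) \<Rightarrow> 'a list \<Rightarrow> (nat \<Rightarrow> 'a) \<Rightarrow> real \<Rightarrow> bool" where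
  "reachable M d h D I C c \<longleftrightarrow>
     (\<exists>S. serves M h I S \<and> (\<forall>i<h. S 0 i = D i) \<and> S (length I) = C \<and>
       schedule_cost d h (length I) S \<le> c)"

lemma reachable_Nil: "configuration M h D \<Longrightarrow> reachable M d h D [] D 0"
  unfolding reachable_def by (rule exI[of _ "\<lambda>_. D"]) (simp add: serves_def schedule_cost_def)

lemma reachable_configuration: "reachable M d h D I C c \<Longrightarrow> configuration M h C"
  by (auto simp: reachable_def serves_def)

lemma reachable_mono: "reachable M d h D I C c \<Longrightarrow> c \<le> c' \<Longrightarrow> reachable M d h D I C c'"
  unfolding reachable_def by force

lemma reachable_snoc:
  assumes "reachable M d h D I C c" and C': "configuration M h C'" and i: "i < h" "C' i = q"
    and cost: "(\<Sum>i<h. d (C i) (C' i)) \<le> b"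
  shows "reachable M d h D (I @ [q]) C' (c + b)"
proof -
  obtain S where S: "serves M h I S" "\<forall>i<h. S 0 i = D i" "S (length I) = C"
    "schedule_cost d h (length I) S \<le> c"
    using assms(1) by (auto simp: reachable_def)
  define S' where "S' t = (if t \<le> length I then S t else C')" for t
  have "serves M h (I @ [q]) S'"
    unfolding serves_def
  proof (intro conjI allI impI)
    fix t assume "t \<le> length (I @ [q])"
    then show "configuration M h (S' t)"
      using S(1) C' by (simp add: S'_def serves_def)
  next
    fix t assume t: "t < length (I @ [q])"
    show "\<exists>i<h. S' (Suc t) i = (I @ [q]) ! t"
    proof (cases "t < length I")
      case True
      then show ?thesis
        using S(1) by (simp add: S'_def serves_def nth_append)
    next
      case False
      with t have "t = length I"
        by simp
      then show ?thesis
        using i by (auto simp: S'_def)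
    qed
  qed
  moreover have "schedule_cost d h (length (I @ [q])) S' \<le> c + b"
    using S(3,4) cost by (simp add: schedule_cost_def S'_def)
  moreover have "\<forall>i<h. S' 0 i = D i" "S' (length (I @ [q])) = C'"
    using S(2) by (simp_all add: S'_def)
  ultimately show ?thesis
    unfolding reachable_def by blast
qed

lemma opt_cost_le_reachable:
  assumes "reachable M d h D I C c" and nonneg: "\<And>u v. 0 \<le> d u v"
  shows "opt_cost M d h D I \<le> c"
proof -
  obtain S where S: "serves M h I S" "\<forall>i<h. S 0 i = D i" "schedule_cost d h (length I) S \<le> c"
    using assms(1) by (auto simp: reachable_def)
  have "opt_cost M d h D I \<le> schedule_cost d h (length I) S"
    unfolding opt_cost_def
  proof (rule cInf_lower)
    show "bdd_below {schedule_cost d h (length I) S |S. serves M h I S \<and> (\<forall>i<h. S 0 i = D i)}"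
      by (rule bdd_belowI[of _ 0]) (auto simp: schedule_cost_def intro!: sum_nonneg nonneg)
  qed (use S in blast)
  with S(3) show ?thesis
    by simp
qed

section \<open>Counting and averaging over \<open>j\<close>-sets of leaves\<close>

definition subsets_with :: "nat \<Rightarrow> nat \<Rightarrow> nat \<Rightarrow> nat set set" where
  "subsets_with J j l = {S. S \<subseteq> {..J} \<and> card S = j \<and> l \<in> S}"

lemma finite_subsets_with [simp]: "finite (subsets_with J j l)"
  by (rule finite_subset[of _ "Pow {..J}"]) (auto simp: subsets_with_def)

lemma card_subsets_containing:
  assumes "finite A" "a \<in> A" "1 \<le> j"
  shows "card {S. S \<subseteq> A \<and> card S = j \<and> a \<in> S} = (card A - 1) choose (j - 1)"
proof -
  have "bij_betw (\<lambda>S. S - {a}) {S. S \<subseteq> A \<and> card S = j \<and> a \<in> S} {T. T \<subseteq> A - {a} \<and> card T = j - 1}"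
  proof (rule bij_betw_byWitness[where f' = "insert a"])
    show "insert a ` {T. T \<subseteq> A - {a} \<and> card T = j - 1} \<subseteq> {S. S \<subseteq> A \<and> card S = j \<and> a \<in> S}"
    proof safe
      fix T assume T: "T \<subseteq> A - {a}" "card T = j - 1"
      then have "finite T" "a \<notin> T"
        using assms(1) by (auto intro: finite_subset)
      then show "card (insert a T) = j"
        using T assms(3) by simp
    qed (use assms in auto)
    show "(\<lambda>S. S - {a}) ` {S. S \<subseteq> A \<and> card S = j \<and> a \<in> S} \<subseteq> {T. T \<subseteq> A - {a} \<and> card T = j - 1}"
      by (auto simp: card_Diff_singleton)
  qed auto
  then show ?thesis
    using n_subsets[of "A - {a}" "j - 1"] assms by (simp add: bij_betw_same_card)
qed

lemma card_subsets_with: "l \<le> J \<Longrightarrow> 1 \<le> j \<Longrightarrow> card (subsets_with J j l) = J choose (j - 1)"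
  using card_subsets_containing[of "{..J}" l j] by (simp add: subsets_with_def)

lemma card_subsets_with_without:
  assumes "l \<le> J" "l' \<le> J" "l \<noteq> l'" "1 \<le> j"
  shows "card {S \<in> subsets_with J j l'. l \<notin> S} = (J - 1) choose (j - 1)"
proof -
  have "{S \<in> subsets_with J j l'. l \<notin> S} = {S. S \<subseteq> {..J} - {l} \<and> card S = j \<and> l' \<in> S}"
    by (auto simp: subsets_with_def)
  then show ?thesis
    using card_subsets_containing[of "{..J} - {l}" l' j] assms by simp
qed

text \<open>
  The average over all \<open>j\<close>-sets of leaves containing the last request: of the sets that contain the
  next request, only those without the last request pay for a move.
\<close>

lemma sum_after_swap:
  fixes c :: "nat set \<Rightarrow> real"
  assumes "l \<le> J" "l' \<le> J" "l \<noteq> l'" "1 \<le> j"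
  shows "(\<Sum>S\<in>subsets_with J j l'. if l \<in> S then c S else c (insert l (S - {l'})) + b)
    = (\<Sum>S\<in>subsets_with J j l. c S) + b * real ((J - 1) choose (j - 1))"
proof -
  let ?both = "{S \<in> subsets_with J j l'. l \<in> S}" and ?new = "{S \<in> subsets_with J j l'. l \<notin> S}"
    and ?old = "{S \<in> subsets_with J j l. l' \<notin> S}"
  have split: "subsets_with J j l' = ?both \<union> ?new" "subsets_with J j l = ?both \<union> ?old"
    by (auto simp: subsets_with_def)
  \<comment> \<open>Stated for arbitrary \<open>a\<close> and \<open>a'\<close> so that it covers
    both directions of the bijection between \<open>?new\<close> and \<open>?old\<close>.\<close>
  have swap: "insert a (S - {a'}) \<in> {S \<in> subsets_with J j a. a' \<notin> S}"
      "insert a' (insert a (S - {a'}) - {a}) = S"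
    if "S \<in> {S \<in> subsets_with J j a'. a \<notin> S}" "a \<le> J" "a \<noteq> a'" for a a' S
  proof -
    have "finite S"
      using that by (auto simp: subsets_with_def intro: finite_subset)
    then show "insert a (S - {a'}) \<in> {S \<in> subsets_with J j a. a' \<notin> S}"
      using that \<open>1 \<le> j\<close> by (auto simp: subsets_with_def card_Diff_singleton)
    show "insert a' (insert a (S - {a'}) - {a}) = S"
      using that by (auto simp: subsets_with_def)
  qed
  have "(\<Sum>S\<in>?new. c (insert l (S - {l'}))) = (\<Sum>S\<in>?old. c S)"
    by (rule sum.reindex_bij_witness[where i = "\<lambda>S. insert l' (S - {l})" and j = "\<lambda>S. insert l (S - {l'})"])
      (use swap[of _ l l'] swap[of _ l' l] assms in \<open>simp_all\<close>)
  moreover have "(\<Sum>S\<in>subsets_with J j l'. if l \<in> S then c S else c (insert l (S - {l'})) + b)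
      = (\<Sum>S\<in>?both. c S) + (\<Sum>S\<in>?new. c (insert l (S - {l'})) + b)"
    by (subst split(1), subst sum.union_disjoint) auto
  moreover have "(\<Sum>S\<in>subsets_with J j l. c S) = (\<Sum>S\<in>?both. c S) + (\<Sum>S\<in>?old. c S)"
    by (subst split(2), subst sum.union_disjoint) (auto simp: subsets_with_def)
  ultimately show ?thesis
    using card_subsets_with_without[OF assms] by (simp add: sum.distrib mult.commute)
qed

lemma exists_le_average:
  fixes c :: "'b \<Rightarrow> real"
  assumes "finite F" "F \<noteq> {}" "(\<Sum>S\<in>F. c S) \<le> real (card F) * a"
  shows "\<exists>S\<in>F. c S \<le> a"
proof (rule ccontr)
  assume "\<not> ?thesis"
  then have "(\<Sum>S\<in>F. a) < (\<Sum>S\<in>F. c S)"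
    using assms by (intro sum_strict_mono) auto
  with assms(3) show False
    by simp
qed

section \<open>Offline servers on a prescribed set of leaves\<close>

definition occupies :: "nat \<Rightarrow> nat \<Rightarrow> nat \<Rightarrow> (nat \<Rightarrow> nat) \<Rightarrow> nat set \<Rightarrow> bool" where
  "occupies s x j C S \<longleftrightarrow> bij_betw C {..<j} (star_leaf s x ` S)"

lemma occupies_served:
  assumes "occupies s x j C S" "l \<in> S"
  shows "\<exists>i<j. C i = star_leaf s x l"
proof -
  have "star_leaf s x l \<in> C ` {..<j}"
    using assms by (auto simp: occupies_def bij_betw_def)
  then show ?thesis
    by auto
qed

lemma inj_star_leaf: "inj (star_leaf s x)"
  by (simp add: inj_def star_leaf_def)

text \<open>Only the servers 0 to \<open>j - 1\<close> move. The bound \<open>b\<close> will be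
  \<open>2 * (1 + leaf_len)\<close> for the first arrival and \<open>2 * leaf_len\<close> for
  regrouping within the star.\<close>

lemma gather:
  assumes C: "configuration (verts (star_tree s)) h C" and "x \<in> {1..s}" "j \<le> h"
    and S: "S \<subseteq> {..<15}" "card S = j"
    and near: "\<And>i l. i < j \<Longrightarrow> l \<in> S \<Longrightarrow> tree_dist (star_tree s) (C i) (star_leaf s x l) \<le> b"
  obtains C' where "configuration (verts (star_tree s)) h C'" "occupies s x j C' S"
    "(\<Sum>i<h. tree_dist (star_tree s) (C i) (C' i)) \<le> real j * b"
proof -
  have "finite S"
    using S(1) by (rule finite_subset) simp
  then obtain g where g: "bij_betw g {..<j} S"
    using ex_bij_betw_nat_finite[of S] S(2) by (auto simp: atLeast0LessThan)
  define C' where "C' i = (if i < j then star_leaf s x (g i) else C i)" for i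
  have gS: "g i \<in> S" if "i < j" for i
    using g that by (auto simp: bij_betw_def)
  have "configuration (verts (star_tree s)) h C'"
    using C gS S(1) star_leaf_in_verts[OF \<open>x \<in> {1..s}\<close>]
    unfolding configuration_def C'_def by auto
  moreover have "occupies s x j C' S"
  proof -
    have "bij_betw (star_leaf s x \<circ> g) {..<j} (star_leaf s x ` S)"
      using g by (rule bij_betw_trans) (simp add: bij_betw_def inj_on_subset[OF inj_star_leaf])
    then show ?thesis
      unfolding occupies_def by (rule bij_betw_cong[THEN iffD1, rotated]) (simp add: C'_def)
  qed
  moreover have "(\<Sum>i<h. tree_dist (star_tree s) (C i) (C' i)) \<le> real j * b"
  proof -
    have "(\<Sum>i<h. tree_dist (star_tree s) (C i) (C' i)) = (\<Sum>i<j. tree_dist (star_tree s) (C i) (C' i))"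
      using \<open>j \<le> h\<close> by (intro sum.mono_neutral_right) (auto simp: C'_def)
    also have "\<dots> \<le> (\<Sum>i<j. b)"
      using near gS by (intro sum_mono) (auto simp: C'_def)
    finally show ?thesis
      by simp
  qed
  ultimately show thesis
    by (rule that)
qed

lemma swap_server:
  assumes C: "configuration (verts (star_tree s)) h C" and x: "x \<in> {1..s}" and "j \<le> h"
    and S: "occupies s x j C S" "l \<in> S" "l' \<notin> S" "l < 15" "l' < 15"
  obtains C' where "configuration (verts (star_tree s)) h C'" "occupies s x j C' (insert l' (S - {l}))"
    "(\<Sum>i<h. tree_dist (star_tree s) (C i) (C' i)) \<le> 2 * leaf_len"
proof -
  obtain i where i: "i < j" "C i = star_leaf s x l"
    using occupies_served[OF S(1,2)] by blast
  define C' where "C' = C(i := star_leaf s x l')"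
  have "configuration (verts (star_tree s)) h C'"
    using C star_leaf_in_verts[OF x S(5)] by (simp add: configuration_def C'_def)
  moreover have "occupies s x j C' (insert l' (S - {l}))"
  proof -
    have "bij_betw C ({..<j} - {i}) (star_leaf s x ` S - {C i})"
      using S(1,2) i unfolding occupies_def by (intro bij_betw_DiffI) auto
    moreover have "star_leaf s x ` S - {C i} = star_leaf s x ` (S - {l})"
      using i(2) inj_star_leaf[of s x] by (auto dest: injD)
    ultimately have "bij_betw C' ({..<j} - {i}) (star_leaf s x ` (S - {l}))"
      by (subst bij_betw_cong[of _ _ C]) (simp_all add: C'_def)
    then have "bij_betw C' (insert i ({..<j} - {i})) (insert (C' i) (star_leaf s x ` (S - {l})))"
      using S(3) inj_star_leaf[of s x]
      by (intro notIn_Un_bij_betw[of i _ C' "star_leaf s x ` (S - {l})", simplified]) (auto simp: C'_def dest: injD)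
    then show ?thesis
      using i(1) by (simp add: occupies_def C'_def insert_absorb)
  qed
  moreover have "(\<Sum>n<h. tree_dist (star_tree s) (C n) (C' n)) \<le> 2 * leaf_len"
  proof -
    have "(\<Sum>n<h. tree_dist (star_tree s) (C n) (C' n)) = (\<Sum>n\<in>{i}. tree_dist (star_tree s) (C n) (C' n))"
      using i(1) \<open>j \<le> h\<close> by (intro sum.mono_neutral_right) (auto simp: C'_def)
    then show ?thesis
      using tree_dist_same_star_le[OF x S(4,5)] i(2) by (simp add: C'_def)
  qed
  ultimately show thesis
    by (rule that)
qed

lemma miss_rate_nonneg: "1 \<le> j \<Longrightarrow> 0 \<le> miss_rate j i"
  by (simp add: miss_rate_def)

text \<open>With \<open>J = max i (j - 1)\<close>, there are \<open>J choose (j - 1)\<close> sets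
  containing the next request, and \<open>(J - 1) choose (j - 1)\<close> of them lack the previous
  one. So \<open>miss_rate\<close> is the fraction of sets that pay for a move.\<close>

lemma miss_rate_choose:
  assumes "1 \<le> i" "1 \<le> j"
  shows "real ((max i (j - 1) - 1) choose (j - 1)) = real (max i (j - 1) choose (j - 1)) * miss_rate j i"
proof -
  define J where "J = max i (j - 1)"
  have J: "1 \<le> J" "j - 1 \<le> J"
    using assms by (auto simp: J_def)
  have "real (J - (j - 1)) * real (J choose (j - 1)) = real J * real ((J - 1) choose (j - 1))"
    using binomial_absorb_comp[of J "j - 1"] by (metis of_nat_mult)
  moreover have "real (J - (j - 1)) = real J + 1 - real j"
    using J assms(2) by (simp add: of_nat_diff)
  ultimately have "(real J + 1 - real j) * real (J choose (j - 1)) = real J * real ((J - 1) choose (j - 1))"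
    by (simp only:)
  then have "real ((J - 1) choose (j - 1)) = (real J + 1 - real j) * real (J choose (j - 1)) / real J"
    using J(1) by (simp only: nonzero_mult_div_cancel_left of_nat_eq_0_iff)
  then show ?thesis
    unfolding miss_rate_def J_def[symmetric] by (simp only: times_divide_eq_right mult.commute)
qed

section \<open>Average offline cost of one round\<close>

context
  fixes s x h j :: nat and D C0 :: "nat \<Rightarrow> nat" and I :: "nat list" and c0 :: real
    and r e :: "nat \<Rightarrow> nat" and N :: nat
  assumes x: "x \<in> {1..s}" and j: "1 \<le> j" "j \<le> 15" "j \<le> h"
    and start: "reachable (verts (star_tree s)) (tree_dist (star_tree s)) h D I C0 c0"
    and r_le: "\<And>n. n < N \<Longrightarrow> r n \<le> e n" and e_le: "\<And>n. n < N \<Longrightarrow> e n \<le> 14"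
    and r_new: "\<And>n. Suc n < N \<Longrightarrow> r (Suc n) \<noteq> r n"
    and mono_e: "mono e" and e_pos: "\<And>n. 1 \<le> n \<Longrightarrow> 1 \<le> e n"
begin

text \<open>The offline servers stay among the leaves \<open>0, \<dots>, pool n\<close> of the star: at least \<open>j\<close> leaves.\<close>

definition pool :: "nat \<Rightarrow> nat" where
  "pool n = max (e n) (j - 1)"

text \<open>First arrival, single moves, and regrouping. The last term telescopes: each growth of
  the pool by at least 1 pays for moving all \<open>j\<close> servers within the star. The sum
  starts at 1 because request 0 is served on arrival.\<close>

definition average_bound :: "nat \<Rightarrow> real" where
  "average_bound n = c0 + 2 * real j * (1 + leaf_len)
     + 2 * leaf_len * (\<Sum>m=1..<Suc n. miss_rate j (e m)) + 2 * leaf_len * real j * (real (pool n) - real (pool 0))"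

text \<open>Index \<open>n\<close> means the situation after \<open>n + 1\<close> requests, the last
  one being \<open>r n\<close>.\<close>

definition can_occupy :: "nat \<Rightarrow> nat set \<Rightarrow> real \<Rightarrow> bool" where
  "can_occupy n S c \<longleftrightarrow>
     (\<exists>C. reachable (verts (star_tree s)) (tree_dist (star_tree s)) h D
        (I @ map (\<lambda>m. star_leaf s x (r m)) [0..<Suc n]) C c \<and> occupies s x j C S)"

lemma pool_le: "n < N \<Longrightarrow> pool n \<le> 14"
  using e_le[of n] j by (simp add: pool_def)

lemma pool_mono: "pool n \<le> pool (Suc n)"
  using monoD[OF mono_e, of n "Suc n"] by (auto simp: pool_def)

lemma subsets_with_pool:
  assumes "n < N" "S \<in> subsets_with (pool n) j (r n)"
  shows "S \<subseteq> {..<15}" "card S = j" "r n \<in> S"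
  using assms pool_le[of n] by (auto simp: subsets_with_def)

lemma subsets_with_pool_nonempty:
  assumes "n < N"
  shows "subsets_with (pool n) j (r n) \<noteq> {}"
proof -
  have "0 < card (subsets_with (pool n) j (r n))"
    using r_le[OF assms] j(1) by (subst card_subsets_with) (auto simp: pool_def)
  then show ?thesis
    by auto
qed

lemma can_occupy_first:
  assumes "0 < N" "S \<in> subsets_with (pool 0) j (r 0)"
  shows "can_occupy 0 S (c0 + real j * (2 * (1 + leaf_len)))"
proof -
  note S = subsets_with_pool[OF assms]
  note conf = reachable_configuration[OF start]
  obtain C where C: "configuration (verts (star_tree s)) h C" "occupies s x j C S"
    "(\<Sum>i<h. tree_dist (star_tree s) (C0 i) (C i)) \<le> real j * (2 * (1 + leaf_len))"
  proof (rule gather[OF conf x j(3) S(1,2)])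
    fix i l assume "i < j" "l \<in> S"
    then show "tree_dist (star_tree s) (C0 i) (star_leaf s x l) \<le> 2 * (1 + leaf_len)"
      using conf j(3) S(1) star_leaf_in_verts[OF x] by (intro tree_dist_le) (auto simp: configuration_def)
  qed
  obtain i where "i < j" "C i = star_leaf s x (r 0)"
    using occupies_served[OF C(2) S(3)] by blast
  then show ?thesis
    using reachable_snoc[OF start C(1) _ _ C(3), of i "star_leaf s x (r 0)"] C(2) j(3)
    unfolding can_occupy_def by (intro exI[of _ C]) simp
qed

text \<open>The common part of regrouping, swapping and staying.\<close>

lemma can_occupy_step:
  assumes "Suc n < N" "can_occupy n S c" "S \<subseteq> {..<15}" "r (Suc n) \<in> S'"
    and step: "\<And>C. configuration (verts (star_tree s)) h C \<Longrightarrow> occupies s x j C S \<Longrightarrow>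
      \<exists>C'. configuration (verts (star_tree s)) h C' \<and> occupies s x j C' S' \<and>
        (\<Sum>i<h. tree_dist (star_tree s) (C i) (C' i)) \<le> b"
  shows "can_occupy (Suc n) S' (c + b)"
proof -
  obtain C where C: "reachable (verts (star_tree s)) (tree_dist (star_tree s)) h D
        (I @ map (\<lambda>m. star_leaf s x (r m)) [0..<Suc n]) C c" "occupies s x j C S"
    using assms(2) by (auto simp: can_occupy_def)
  obtain C' where C': "configuration (verts (star_tree s)) h C'" "occupies s x j C' S'"
    "(\<Sum>i<h. tree_dist (star_tree s) (C i) (C' i)) \<le> b"
    using step[OF reachable_configuration[OF C(1)] C(2)] by blast
  obtain i where "i < j" "C' i = star_leaf s x (r (Suc n))"
    using occupies_served[OF C'(2) assms(4)] by blast
  then show ?thesis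
    using reachable_snoc[OF C(1) C'(1) _ _ C'(3), of i "star_leaf s x (r (Suc n))"] C'(2) j(3)
    unfolding can_occupy_def by (intro exI[of _ C']) simp
qed

lemma can_occupy_regroup:
  assumes "Suc n < N" "can_occupy n S c" "S \<in> subsets_with (pool n) j (r n)"
    and S': "S' \<in> subsets_with (pool (Suc n)) j (r (Suc n))"
  shows "can_occupy (Suc n) S' (c + real j * (2 * leaf_len))"
proof (rule can_occupy_step[OF assms(1,2)])
  have "n < N"
    using assms(1) by simp
  note S = subsets_with_pool[OF this assms(3)]
  note S' = subsets_with_pool[OF assms(1) S']
  show "S \<subseteq> {..<15}" "r (Suc n) \<in> S'"
    by fact+
  fix C assume C: "configuration (verts (star_tree s)) h C" "occupies s x j C S"
  show "\<exists>C'. configuration (verts (star_tree s)) h C' \<and> occupies s x j C' S' \<and>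
      (\<Sum>i<h. tree_dist (star_tree s) (C i) (C' i)) \<le> real j * (2 * leaf_len)"
  proof (rule gather[OF C(1) x j(3) S'(1,2)])
    fix i l assume "i < j" "l \<in> S'"
    then obtain m where "m \<in> S" "C i = star_leaf s x m"
      using C(2) unfolding occupies_def by (meson bij_betwE imageE lessThan_iff)
    then show "tree_dist (star_tree s) (C i) (star_leaf s x l) \<le> 2 * leaf_len"
      using S(1) S'(1) \<open>l \<in> S'\<close> by (auto intro!: tree_dist_same_star_le[OF x])
  qed blast
qed

lemma can_occupy_swap:
  assumes "Suc n < N" "can_occupy n S c" "S \<in> subsets_with (pool n) j (r n)" "r (Suc n) \<notin> S"
  shows "can_occupy (Suc n) (insert (r (Suc n)) (S - {r n})) (c + 2 * leaf_len)"
proof (rule can_occupy_step[OF assms(1,2)])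
  have "n < N"
    using assms(1) by simp
  note S = subsets_with_pool[OF this assms(3)]
  show "S \<subseteq> {..<15}"
    by fact
  fix C assume C: "configuration (verts (star_tree s)) h C" "occupies s x j C S"
  have "r n < 15" "r (Suc n) < 15"
    using S r_le[OF assms(1)] e_le[OF assms(1)] by auto
  from swap_server[OF C(1) x j(3) C(2) S(3) assms(4) this]
  show "\<exists>C'. configuration (verts (star_tree s)) h C' \<and>
      occupies s x j C' (insert (r (Suc n)) (S - {r n})) \<and>
      (\<Sum>i<h. tree_dist (star_tree s) (C i) (C' i)) \<le> 2 * leaf_len"
    by blast
qed simp

lemma can_occupy_stay:
  assumes "Suc n < N" "can_occupy n S c" "S \<in> subsets_with (pool n) j (r n)" "r (Suc n) \<in> S"
  shows "can_occupy (Suc n) S c"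
proof -
  have "can_occupy (Suc n) S (c + 0)"
  proof (rule can_occupy_step[OF assms(1,2)])
    show "S \<subseteq> {..<15}"
      using subsets_with_pool(1)[OF _ assms(3)] assms(1) by simp
    fix C assume "configuration (verts (star_tree s)) h C" "occupies s x j C S"
    then show "\<exists>C'. configuration (verts (star_tree s)) h C' \<and> occupies s x j C' S \<and>
      (\<Sum>i<h. tree_dist (star_tree s) (C i) (C' i)) \<le> 0"
      by (intro exI[of _ C]) simp
  qed fact
  then show ?thesis
    by simp
qed

text \<open>The induction maintains one schedule for every \<open>j\<close>-set of the pool that
  contains the last request. Controlling the average is enough, as a set of at most average cost can
  be picked at the end and whenever the pool grows.\<close>

lemma average_can_occupy:
  assumes "n < N"
  shows "\<exists>c. (\<forall>S\<in>subsets_with (pool n) j (r n). can_occupy n S (c S)) \<and>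
    (\<Sum>S\<in>subsets_with (pool n) j (r n). c S)
      \<le> real (card (subsets_with (pool n) j (r n))) * average_bound n"
  using assms
proof (induction n)
  case 0
  have "average_bound 0 = c0 + real j * (2 * (1 + leaf_len))"
    by (simp add: average_bound_def)
  then have "can_occupy 0 S (average_bound 0)" if "S \<in> subsets_with (pool 0) j (r 0)" for S
    using can_occupy_first[OF 0 that] by (simp only:)
  then show ?case
    by (intro exI[of _ "\<lambda>_. average_bound 0"]) simp
next
  case (Suc n)
  then have "n < N"
    by simp
  let ?F = "subsets_with (pool n) j (r n)" and ?F' = "subsets_with (pool (Suc n)) j (r (Suc n))"
  obtain c where c: "\<And>S. S \<in> ?F \<Longrightarrow> can_occupy n S (c S)"
    and average: "(\<Sum>S\<in>?F. c S) \<le> real (card ?F) * average_bound n"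
    using Suc.IH[OF \<open>n < N\<close>] by blast
  let ?miss = "miss_rate j (e (Suc n))"
  have bound_Suc: "average_bound (Suc n)
      = average_bound n + 2 * leaf_len * ?miss + 2 * leaf_len * real j * (real (pool (Suc n)) - real (pool n))"
    by (simp add: average_bound_def algebra_simps)
  have r_pool: "r n \<le> pool n" "r (Suc n) \<le> pool (Suc n)"
    using r_le[OF \<open>n < N\<close>] r_le[OF Suc.prems] by (auto simp: pool_def)
  show ?case
  proof (cases "pool (Suc n) = pool n")
    case True
    \<comment> \<open>A set without the previous request \<open>r n\<close> is reached by one move
      from the set that has \<open>r n\<close> in place of \<open>r (Suc n)\<close>.\<close>
    define c' where "c' S = (if r n \<in> S then c S else c (insert (r n) (S - {r (Suc n)})) + 2 * leaf_len)" for S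
    have "can_occupy (Suc n) S (c' S)" if S: "S \<in> ?F'" for S
    proof (cases "r n \<in> S")
      case in_S: True
      then have "S \<in> ?F" "r (Suc n) \<in> S"
        using S \<open>pool (Suc n) = pool n\<close> by (auto simp: subsets_with_def)
      with in_S show ?thesis
        using can_occupy_stay[OF Suc.prems c] by (simp add: c'_def)
    next
      case False
      let ?S = "insert (r n) (S - {r (Suc n)})"
      have "finite S"
        using S by (auto simp: subsets_with_def intro: finite_subset)
      then have "?S \<in> ?F" "r (Suc n) \<notin> ?S" "insert (r (Suc n)) (?S - {r n}) = S"
        using S False \<open>pool (Suc n) = pool n\<close> r_pool(1) r_new[OF Suc.prems] j(1)
        by (auto simp: subsets_with_def card_Diff_singleton)
      with False show ?thesis
        using can_occupy_swap[OF Suc.prems c, of ?S] by (simp add: c'_def)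
    qed
    moreover have "(\<Sum>S\<in>?F'. c' S) \<le> real (card ?F') * average_bound (Suc n)"
    proof -
      have "(\<Sum>S\<in>?F'. c' S) = (\<Sum>S\<in>?F. c S) + 2 * leaf_len * real ((pool n - 1) choose (j - 1))"
        unfolding c'_def True using r_pool r_new[OF Suc.prems] j(1) True
        by (intro sum_after_swap) auto
      also have "real ((pool n - 1) choose (j - 1)) = real (card ?F') * ?miss"
        using miss_rate_choose[OF e_pos[of "Suc n"] j(1), folded pool_def] card_subsets_with[OF r_pool(2) j(1)]
        by (simp add: True)
      also have "(\<Sum>S\<in>?F. c S) \<le> real (card ?F') * average_bound n"
        using average card_subsets_with[OF r_pool(1) j(1)] card_subsets_with[OF r_pool(2) j(1)] True by simp
      finally show ?thesis
        by (simp add: bound_Suc True algebra_simps)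
    qed
    ultimately show ?thesis
      by blast
  next
    case False
    \<comment> \<open>When the pool grows, every new set is reached from a single set
      \<open>S0\<close> of at most average cost, by moving all \<open>j\<close> servers.\<close>
    then have "pool n + 1 \<le> pool (Suc n)"
      using pool_mono[of n] by simp
    then have "real (pool n) + 1 \<le> real (pool (Suc n))"
      by linarith
    then have "2 * leaf_len * real j * 1 \<le> 2 * leaf_len * real j * (real (pool (Suc n)) - real (pool n))"
      using leaf_len_pos by (intro mult_left_mono) auto
    moreover have "0 \<le> 2 * leaf_len * ?miss"
      using leaf_len_pos miss_rate_nonneg[OF j(1)] by simp
    moreover obtain S0 where S0: "S0 \<in> ?F" "c S0 \<le> average_bound n"
      using exists_le_average[OF finite_subsets_with subsets_with_pool_nonempty[OF \<open>n < N\<close>] average] by blast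
    ultimately have "c S0 + real j * (2 * leaf_len) \<le> average_bound (Suc n)"
      unfolding bound_Suc by (simp add: algebra_simps)
    moreover have "can_occupy (Suc n) S (c S0 + real j * (2 * leaf_len))" if "S \<in> ?F'" for S
      by (rule can_occupy_regroup[OF Suc.prems c[OF S0(1)] S0(1) that])
    ultimately show ?thesis
      by (intro exI[of _ "\<lambda>_. c S0 + real j * (2 * leaf_len)"]) (simp add: mult_left_mono)
  qed
qed

lemma adversary_reachable:
  assumes "1 \<le> N"
  shows "\<exists>C. reachable (verts (star_tree s)) (tree_dist (star_tree s)) h D
    (I @ map (\<lambda>m. star_leaf s x (r m)) [0..<N]) C (c0 + 2 * adversary_bound j e N)"
proof -
  obtain n where n: "N = Suc n"
    using assms by (cases N) auto
  then have "n < N"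
    by simp
  then obtain c where c: "\<forall>S\<in>subsets_with (pool n) j (r n). can_occupy n S (c S)"
    "(\<Sum>S\<in>subsets_with (pool n) j (r n). c S)
      \<le> real (card (subsets_with (pool n) j (r n))) * average_bound n"
    using average_can_occupy by blast
  obtain S where S: "S \<in> subsets_with (pool n) j (r n)" "c S \<le> average_bound n"
    using exists_le_average[OF finite_subsets_with subsets_with_pool_nonempty[OF \<open>n < N\<close>] c(2)] by blast
  obtain C where C: "reachable (verts (star_tree s)) (tree_dist (star_tree s)) h D
      (I @ map (\<lambda>m. star_leaf s x (r m)) [0..<N]) C (c S)"
    using c(1) S(1) unfolding can_occupy_def n by blast
  \<comment> \<open>The pool index rises from at least 0 to at most 14, which explains the last term
    of \<open>adversary_bound\<close>.\<close>
  have "2 * leaf_len * real j * (real (pool n) - real (pool 0)) \<le> 2 * leaf_len * real j * 14"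
    using leaf_len_pos pool_le[OF \<open>n < N\<close>] by (intro mult_left_mono) auto
  then have "average_bound n \<le> c0 + 2 * adversary_bound j e N"
    unfolding average_bound_def adversary_bound_def n by (simp add: algebra_simps)
  with S(2) have "c S \<le> c0 + 2 * adversary_bound j e N"
    by simp
  with C show ?thesis
    using reachable_mono by blast
qed

end

section \<open>The lower bound\<close>

text \<open>One round in an empty star. The gain 2/25 does not depend on the past, and the next
  round can start from \<open>I'\<close>, \<open>C'\<close> and \<open>c'\<close>.\<close>

lemma adversary_round:
  assumes alg: "online_algorithm (verts (star_tree (Suc k))) (leaves (star_tree (Suc k))) k A"
    and "15 \<le> h" and I: "I \<in> lists (leaves (star_tree (Suc k)))"
    and start: "reachable (verts (star_tree (Suc k))) (tree_dist (star_tree (Suc k))) h D I C c"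
  shows "\<exists>I' C' c'. I' \<in> lists (leaves (star_tree (Suc k))) \<and>
    reachable (verts (star_tree (Suc k))) (tree_dist (star_tree (Suc k))) h D I' C' c' \<and>
    alg_cost (tree_dist (star_tree (Suc k))) k A I + 2.4 * (c' - c) + 2/25
      + potential (Suc k) k (A I) - potential (Suc k) k (A I')
    \<le> alg_cost (tree_dist (star_tree (Suc k))) k A I'"
proof -
  let ?s = "Suc k"
  obtain x where x: "x \<in> {1..?s}" and empty: "inside ?s x k (A I) = 0"
    using exists_empty_star[OF online_configuration[OF alg I]] by blast
  define R where "R = hard_requests A ?s k x I"
  define r where "r = hard_leaf A ?s k x I"
  define e where "e = entries A ?s k x I"
  note cost = hard_requests_cost[where A = A and I = I, OF alg I x empty, folded R_def r_def e_def]
  note uncovered = hard_leaf_uncovered[where A = A and I = I, OF x empty, folded R_def r_def e_def]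
  have "mono e"
    unfolding e_def by (rule mono_entries)
  have e0: "e 0 = 0"
    by (simp add: e_def entries_def)
  \<comment> \<open>The star is empty at first, so serving request 0 brings a server into
    it.\<close>
  have e_pos: "1 \<le> e n" if "1 \<le> n" for n
  proof -
    have few: "e m \<le> 14" if "m < Suc 0" for m
      using that e0 by simp
    obtain i where i: "i < k" "A (R (Suc 0)) i = star_leaf ?s x (r 0)"
      using cost[OF few] by blast
    have "r 0 < 15"
      using uncovered(1)[of 0] e0 by simp
    then have "{i} \<subseteq> {i \<in> {..<k}. x \<in> ancestors (star_tree ?s) (A (R (Suc 0)) i)}"
      using i x by (simp add: ancestors_leaf)
    then have "card {i} \<le> inside ?s x k (A (R (Suc 0)))"
      unfolding inside_def by (rule card_mono[rotated]) simp
    also have "\<dots> \<le> e (Suc 0)"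
      unfolding R_def e_def by (rule inside_le_entries[where A = A and I = I, OF empty])
    also have "\<dots> \<le> e n"
      using that by (intro monoD[OF \<open>mono e\<close>]) simp
    finally show ?thesis
      by simp
  qed
  obtain N j where "1 \<le> N" and j: "j \<in> {1..15}" and few: "\<And>n. n < N \<Longrightarrow> e n \<le> 14"
    and gain: "2.4 * adversary_bound j e N + 1/25 \<le> real (e N) + leaf_len * real N"
    using adversary_can_stop[of e, OF \<open>mono e\<close> e0 e_pos] by blast
  have R: "R N \<in> lists (leaves (star_tree ?s))"
    and costN: "alg_cost (tree_dist (star_tree ?s)) k A I + 2 * (real (e N) + leaf_len * real N)
      + potential ?s k (A I) - potential ?s k (A (R N)) \<le> alg_cost (tree_dist (star_tree ?s)) k A (R N)"
    and served: "\<And>n. n < N \<Longrightarrow> \<exists>i<k. A (R (Suc n)) i = star_leaf ?s x (r n)"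
    using cost[of N, OF few] by blast+
  have r_le: "r n \<le> e n" if "n < N" for n
    by (rule uncovered(1)[OF few[OF that]])
  \<comment> \<open>The algorithm has just covered leaf \<open>r n\<close>, whereas the next
    requested leaf is uncovered.\<close>
  have r_new: "r (Suc n) \<noteq> r n" if "Suc n < N" for n
  proof -
    have "\<exists>i<k. A (R (Suc n)) i = star_leaf ?s x (r n)"
      using served that by simp
    then have "star_leaf ?s x (r n) \<in> A (R (Suc n)) ` {..<k}"
      by force
    then show ?thesis
      using uncovered(2)[OF few[OF that]] by auto
  qed
  have "1 \<le> j" "j \<le> 15" "j \<le> h"
    using j \<open>15 \<le> h\<close> by simp_all
  from adversary_reachable[OF x this start r_le few r_new \<open>mono e\<close> e_pos \<open>1 \<le> N\<close>]
  obtain C' where "reachable (verts (star_tree ?s)) (tree_dist (star_tree ?s)) h D (R N) C'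
      (c + 2 * adversary_bound j e N)"
    unfolding R_def hard_requests_eq r_def[symmetric] by blast
  \<comment> \<open>The inequality \<open>gain\<close> compares halves of costs, so its surplus 1/25
    becomes 2/25.\<close>
  moreover have "alg_cost (tree_dist (star_tree ?s)) k A I + 2.4 * (c + 2 * adversary_bound j e N - c) + 2/25
      + potential ?s k (A I) - potential ?s k (A (R N)) \<le> alg_cost (tree_dist (star_tree ?s)) k A (R N)"
    using costN gain by argo
  ultimately show ?thesis
    using R by blast
qed

lemma potential_nonneg: "0 \<le> potential s k C"
  unfolding potential_def by (intro sum_nonneg height_nonneg)

lemma potential_le:
  assumes "configuration (verts (star_tree s)) k C"
  shows "potential s k C \<le> real k * (1 + leaf_len)"
proof -
  have "potential s k C \<le> (\<Sum>i<k. 1 + leaf_len)"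
    unfolding potential_def using assms by (intro sum_mono height_le) (auto simp: configuration_def)
  then show ?thesis
    by simp
qed

lemma star_tree_not_competitive:
  assumes alg: "online_algorithm (verts (star_tree (Suc k))) (leaves (star_tree (Suc k))) k A"
    and D: "configuration (verts (star_tree (Suc k))) h D" and "15 \<le> h"
  shows "\<not> competitive (verts (star_tree (Suc k))) (leaves (star_tree (Suc k)))
    (tree_dist (star_tree (Suc k))) h k D 2.4 A"
proof
  let ?T = "star_tree (Suc k)"
  assume "competitive (verts ?T) (leaves ?T) (tree_dist ?T) h k D 2.4 A"
  then obtain \<alpha> where competitive: "\<And>I. I \<in> lists (leaves ?T) \<Longrightarrow>
      alg_cost (tree_dist ?T) k A I \<le> 2.4 * opt_cost (verts ?T) (tree_dist ?T) h D I + \<alpha>"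
    by (auto simp: competitive_def)
  have rounds: "\<exists>I C c. I \<in> lists (leaves ?T) \<and> reachable (verts ?T) (tree_dist ?T) h D I C c \<and>
      2.4 * c + 2/25 * real n + potential (Suc k) k (A []) - potential (Suc k) k (A I)
      \<le> alg_cost (tree_dist ?T) k A I" for n
  proof (induction n)
    case 0
    show ?case
      using reachable_Nil[OF D, of "tree_dist ?T"]
      by (intro exI[of _ "[]"] exI[of _ D] exI[of _ 0]) (simp add: alg_cost_def schedule_cost_def)
  next
    case (Suc n)
    then obtain I C c where I: "I \<in> lists (leaves ?T)" "reachable (verts ?T) (tree_dist ?T) h D I C c"
      and bound: "2.4 * c + 2/25 * real n + potential (Suc k) k (A []) - potential (Suc k) k (A I)
        \<le> alg_cost (tree_dist ?T) k A I"
      by blast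
    obtain I' C' c' where I': "I' \<in> lists (leaves ?T)" "reachable (verts ?T) (tree_dist ?T) h D I' C' c'"
      and bound': "alg_cost (tree_dist ?T) k A I + 2.4 * (c' - c) + 2/25
        + potential (Suc k) k (A I) - potential (Suc k) k (A I') \<le> alg_cost (tree_dist ?T) k A I'"
      using adversary_round[OF alg \<open>15 \<le> h\<close> I] by blast
    have "2.4 * c' + 2/25 * real (Suc n) + potential (Suc k) k (A []) - potential (Suc k) k (A I')
        \<le> alg_cost (tree_dist ?T) k A I'"
      using bound bound' unfolding of_nat_Suc by argo
    with I' show ?case
      by blast
  qed
  \<comment> \<open>Enough rounds for the surplus \<open>2/25 * n\<close> to exceed \<alpha> plus
    the largest possible potential.\<close>
  obtain n :: nat where n: "25/2 * (\<alpha> + real k * (1 + leaf_len)) < real n"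
    using reals_Archimedean2 by blast
  obtain I C c where I: "I \<in> lists (leaves ?T)" and reach: "reachable (verts ?T) (tree_dist ?T) h D I C c"
    and bound: "2.4 * c + 2/25 * real n + potential (Suc k) k (A []) - potential (Suc k) k (A I)
      \<le> alg_cost (tree_dist ?T) k A I"
    using rounds by blast
  have "opt_cost (verts ?T) (tree_dist ?T) h D I \<le> c"
    using reach Metric_space.nonneg[OF Metric_space_star_tree] by (rule opt_cost_le_reachable)
  then show False
    using bound competitive[OF I] n potential_nonneg[of "Suc k" k "A []"]
      potential_le[OF online_configuration[OF alg I]] by argo
qed

theorem theorem4:
  "\<exists>h0::nat. \<forall>h\<ge>h0. \<forall>k\<ge>h.
     (\<nexists>A :: nat set \<Rightarrow> (nat \<Rightarrow> nat \<Rightarrow> real) \<Rightarrow> nat algorithm.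
        \<forall>M d. Metric_space M d \<and> M \<noteq> {} \<longrightarrow>
          online_algorithm M M k (A M d) \<and>
          (\<forall>D. configuration M h D \<longrightarrow> competitive M M d h k D 2.4 (A M d))) \<and>
     (\<exists>T :: nat wtree. depth2_HST T \<and>
        (\<forall>A D. online_algorithm (verts T) (leaves T) k A \<and> configuration (verts T) h D \<longrightarrow>
           \<not> competitive (verts T) (leaves T) (tree_dist T) h k D 2.4 A))"
\<comment> \<open>With 15 offline servers every choice of \<open>j\<close> in a round is possible,
  whatever \<open>k\<close> is; only the number of stars depends on \<open>k\<close>.\<close>
proof (intro exI[of _ 15] allI impI conjI)
  fix h k :: nat assume "15 \<le> h" "h \<le> k"
  let ?T = "star_tree (Suc k)"
  show "\<nexists>A :: nat set \<Rightarrow> (nat \<Rightarrow> nat \<Rightarrow> real) \<Rightarrow> nat algorithm.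
        \<forall>M d. Metric_space M d \<and> M \<noteq> {} \<longrightarrow>
          online_algorithm M M k (A M d) \<and>
          (\<forall>D. configuration M h D \<longrightarrow> competitive M M d h k D 2.4 (A M d))"
  proof
    assume "\<exists>A :: nat set \<Rightarrow> (nat \<Rightarrow> nat \<Rightarrow> real) \<Rightarrow> nat algorithm.
        \<forall>M d. Metric_space M d \<and> M \<noteq> {} \<longrightarrow>
          online_algorithm M M k (A M d) \<and>
          (\<forall>D. configuration M h D \<longrightarrow> competitive M M d h k D 2.4 (A M d))"
    then obtain A :: "nat set \<Rightarrow> (nat \<Rightarrow> nat \<Rightarrow> real) \<Rightarrow> nat algorithm" where
      A: "\<And>M d. Metric_space M d \<Longrightarrow> M \<noteq> {} \<Longrightarrow>
        online_algorithm M M k (A M d) \<and>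
        (\<forall>D. configuration M h D \<longrightarrow> competitive M M d h k D 2.4 (A M d))"
      by blast
    let ?A = "A (verts ?T) (tree_dist ?T)"
    have root: "0 \<in> verts ?T"
      by (simp add: verts_star_tree)
    then have D: "configuration (verts ?T) h (\<lambda>_. 0)"
      by (simp add: configuration_def)
    have A_tree: "online_algorithm (verts ?T) (verts ?T) k ?A"
      "competitive (verts ?T) (verts ?T) (tree_dist ?T) h k (\<lambda>_. 0) 2.4 ?A"
      using A[OF Metric_space_star_tree] root D by blast+
    \<comment> \<open>Restricting the requests to leaves preserves both properties, since
      \<open>opt_cost\<close> lets the servers use all of \<open>verts ?T\<close> in either
      case.\<close>
    have "lists (leaves ?T) \<subseteq> lists (verts ?T)"
      by (intro lists_mono leaves_subset_verts)
    then have "online_algorithm (verts ?T) (leaves ?T) k ?A"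
      "competitive (verts ?T) (leaves ?T) (tree_dist ?T) h k (\<lambda>_. 0) 2.4 ?A"
      using A_tree unfolding online_algorithm_def competitive_def by blast+
    then show False
      using star_tree_not_competitive[OF _ D \<open>15 \<le> h\<close>] by blast
  qed
  show "\<exists>T :: nat wtree. depth2_HST T \<and>
        (\<forall>A D. online_algorithm (verts T) (leaves T) k A \<and> configuration (verts T) h D \<longrightarrow>
           \<not> competitive (verts T) (leaves T) (tree_dist T) h k D 2.4 A)"
    using depth2_HST_star_tree[of "Suc k"] star_tree_not_competitive[OF _ _ \<open>15 \<le> h\<close>]
    by (intro exI[of _ ?T]) simp
qed

end
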